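(* For stochastic online scheduling on unrelated parallel machines with release dates (online-time model), the expected total weighted completion time $\mathbb{E}[\sum_j w_jC_j]$ of the Greedy Algorithm described in the context (with $f=2$) is at most $(72+36\Delta)\,\mathsf{OPT}$ for every instance; i.e. the Greedy Algorithm is $(72+36\Delta)$-competitive.
   Context: Model: a finite set $M$ of machines and a finite set $J$ of jobs. Job $j$ has weight $w_j\ge0$, release date $r_j\ge 0$, and for each machine $i$ a processing-time random variable $P_{ij}$ taking nonnegative integer values, with $\mathbb{E}[P_{ij}]\in(0,\infty]$ ($\infty$ meaning $j$ cannot run on $i$). For a fixed job the $P_{ij}$ may be dependent across machines; the vectors $(P_{ij})_{i\in M}$ of different jobs are independent. Jobs are nonpreemptive, each runs on exactly one machine, no job starts before its release date, each machine processes one job at a time, and the realized processing time of a job is revealed only upon its completion. $\Delta:=\max_{i,j}\mathrm{Var}[P_{ij}]/\mathbb{E}[P_{ij}]^2$. $\mathsf{OPT}$ is the expected total weighted completion time of an optimal non-anticipatory scheduling policy (decisions at time $t$ use only information available at time $t$; it need not assign jobs at their release). Online-time model: the existence of job $j$, its weight and the distributions of $P_{ij}$ become known only at time $r_j$. Jobs are indexed so that $r_j\le r_k$ for $j<k$. Notation: $H(j,i):=\{k: w_k/\mathbb{E}[P_{ik}]>w_j/\mathbb{E}[P_{ij}]\}\cup\{k: k\le j,\ w_k/\mathbb{E}[P_{ik}]=w_j/\mathbb{E}[P_{ij}]\}$, $L(j,i):=J\setminus H(j,i)$; $k\to i$ means $k$ has been assigned to $i$. Modified release dates: $r_{ij}:=\max\{f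 r_j,\mathbb{E}[P_{ij}]\}$ with $f=2$. Greedy Algorithm: (1) At time $r_j$, compute for every machine $i$ $$\mathrm{incr}(j\to i):=w_j\Big(2r_{ij}+\sum_{k\to i,\,k\le j,\,k\in H(j,i)}\mathbb{E}[P_{ik}]\Big)+\mathbb{E}[P_{ij}]\sum_{k\to i,\,k<j,\,k\in L(j,i)}w_k$$ (with $j$ counted in the first sum), and irrevocably assign $j$ to a machine minimizing it. (2) Whenever machine $i$ is idle at time $t$ and there are unfinished jobs $k$ assigned to $i$ with $r_{ik}\le t$, choose such a $k$ with largest $w_k/\mathbb{E}[P_{ik}]$; the machine then stays idle for $\mathbb{E}[P_{ik}]$ further time units and afterwards processes $k$ to completion. *)

theory Defs
  imports "HOL-Probability.Probability" "HOL-Probability.Product_PMF"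
begin

text \<open>
  The jobs are \<open>0, \<dots>, njobs I - 1\<close>.  The random vector of processing times of job \<open>j\<close> on all
  machines has the joint distribution \<open>law I j\<close>, so it may be dependent across machines; its
  values outside \<open>machines I\<close> are irrelevant.  Different jobs are independent: a realization is
  drawn from the product of these distributions.
\<close>

record 'm sched_inst =
  machines :: "'m set"
  njobs :: nat
  weight :: "nat \<Rightarrow> real"
  release :: "nat \<Rightarrow> real"
  law :: "nat \<Rightarrow> ('m \<Rightarrow> nat) pmf"

type_synonym 'm realization = "nat \<Rightarrow> 'm \<Rightarrow> nat"

definition realizations :: "'m sched_inst \<Rightarrow> 'm realization pmf" where
  "realizations I = Pi_pmf {..<njobs I} (\<lambda>_. 0) (law I)"

definition EP :: "'m sched_inst \<Rightarrow> 'm \<Rightarrow> nat \<Rightarrow> ennreal" where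
  "EP I i j = (\<integral>\<^sup>+ v. ennreal (real (v i)) \<partial>measure_pmf (law I j))"

definition can_run :: "'m sched_inst \<Rightarrow> 'm \<Rightarrow> nat \<Rightarrow> bool" where
  "can_run I i j \<longleftrightarrow> i \<in> machines I \<and> EP I i j < \<infinity>"

definition valid_inst :: "'m sched_inst \<Rightarrow> bool" where
  "valid_inst I \<longleftrightarrow>
     finite (machines I) \<and>
     (\<forall>j<njobs I. 0 \<le> weight I j \<and> 0 \<le> release I j) \<and>
     (\<forall>j k. j < k \<and> k < njobs I \<longrightarrow> release I j \<le> release I k) \<and>
     (\<forall>i\<in>machines I. \<forall>j<njobs I. 0 < EP I i j)"

text \<open>The real-valued expectation; only meaningful where \<open>EP I i j\<close> is finite.\<close>

definition mean :: "'m sched_inst \<Rightarrow> 'm \<Rightarrow> nat \<Rightarrow> real" where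
  "mean I i j = enn2real (EP I i j)"

text \<open>
  The variance is taken in \<open>ennreal\<close>, since the Bochner integral would turn an infinite variance
  into \<open>0\<close>.  The supremum is over finitely many pairs, hence a maximum (and \<open>0\<close> if there are none).
\<close>

definition Delta :: "'m sched_inst \<Rightarrow> ennreal" where
  "Delta I = (SUP (i, j) \<in> {(i, j). j < njobs I \<and> can_run I i j}.
     (\<integral>\<^sup>+ v. ennreal ((real (v i) - mean I i j)\<^sup>2) \<partial>measure_pmf (law I j)) / (EP I i j)\<^sup>2)"

text \<open>
  At every decision point a policy may do one of two things.  \<open>Process j i d\<close> commits the idle
  machine \<open>i\<close> to job \<open>j\<close>: the machine is kept idle for \<open>d\<close> further time units and then processes
  \<open>j\<close> to completion (\<open>d = 0\<close> starts \<open>j\<close> immediately).  \<open>Wait \<tau>\<close> does nothing until the tentative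
  decision time \<open>\<tau>\<close> (if any), the next completion or the next release, whichever is first.
\<close>

datatype 'm action = Process nat 'm real | Wait "real option"

text \<open>
  What is known at a given time about each job: \<open>None\<close> if no machine was committed to it so far,
  and otherwise its machine, its start time, and its processing time if it is completed.  Together
  with the current time this determines the whole observable past.  A policy maps it to an action,
  so it is non-anticipatory by construction.
\<close>

type_synonym 'm obs = "nat \<Rightarrow> ('m \<times> real \<times> nat option) option"
type_synonym 'm policy = "real \<Rightarrow> 'm obs \<Rightarrow> 'm action"
type_synonym 'm schedule = "nat \<Rightarrow> ('m \<times> real) option"

definition observe :: "'m realization \<Rightarrow> real \<Rightarrow> 'm schedule \<Rightarrow> 'm obs" where
  "observe p t S = (\<lambda>j. map_option
     (\<lambda>(i, s). (i, s, if s + real (p j i) \<le> t then Some (p j i) else None)) (S j))"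

definition idle :: "'m obs \<Rightarrow> 'm \<Rightarrow> bool" where
  "idle Ob i \<longleftrightarrow> (\<forall>j s. Ob j \<noteq> Some (i, s, None))"

text \<open>
  An inadmissible action leaves the state unchanged, so that a policy choosing it is stuck forever.
  Jobs with processing time \<open>0\<close> are handled since several steps may take place at the same time.
\<close>

fun step :: "'m sched_inst \<Rightarrow> 'm policy \<Rightarrow> 'm realization \<Rightarrow>
    real \<times> 'm schedule \<Rightarrow> real \<times> 'm schedule" where
  "step I \<pi> p (t, S) =
     (case \<pi> t (observe p t S) of
        Process j i d \<Rightarrow>
          if j < njobs I \<and> S j = None \<and> can_run I i j \<and> release I j \<le> t \<and>
             idle (observe p t S) i \<and> 0 \<le> d
          then (t, S(j \<mapsto> (i, t + d)))
          else (t, S)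
      | Wait \<tau> \<Rightarrow>
          let E = {u \<in> set_option \<tau> \<union> release I ` {..<njobs I} \<union>
                       {s + real (p j i) |j i s. S j = Some (i, s)}. t < u}
          in (if E = {} then t else Min E, S))"

definition run :: "'m sched_inst \<Rightarrow> 'm policy \<Rightarrow> 'm realization \<Rightarrow> nat \<Rightarrow> real \<times> 'm schedule" where
  "run I \<pi> p m = (step I \<pi> p ^^ m) (0, \<lambda>_. None)"

text \<open>
  The machine and the start time of a job are never changed once they are set, so the infimum
  ranges over at most one pair; it is \<open>\<infinity>\<close> for a job that is never started.
\<close>

definition completion :: "'m sched_inst \<Rightarrow> 'm policy \<Rightarrow> 'm realization \<Rightarrow> nat \<Rightarrow> ennreal" where
  "completion I \<pi> p j =
     (INF (i, s) \<in> {(i, s). \<exists>m. snd (run I \<pi> p m) j = Some (i, s)}. ennreal (s + real (p j i)))"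

definition cost :: "'m sched_inst \<Rightarrow> 'm policy \<Rightarrow> ennreal" where
  "cost I \<pi> = (\<integral>\<^sup>+ p. (\<Sum>j<njobs I. ennreal (weight I j) * completion I \<pi> p j)
     \<partial>measure_pmf (realizations I))"

definition feasible_policy :: "'m sched_inst \<Rightarrow> 'm policy \<Rightarrow> bool" where
  "feasible_policy I \<pi> \<longleftrightarrow>
     (\<forall>p\<in>set_pmf (realizations I). \<forall>j<njobs I. completion I \<pi> p j < \<infinity>)"

definition OPT :: "'m sched_inst \<Rightarrow> ennreal" where
  "OPT I = (INF \<pi> \<in> {\<pi>. feasible_policy I \<pi>}. cost I \<pi>)"

text \<open>
  For \<open>EP I i j = \<infinity>\<close> the value is \<open>weight I j / 0 = 0\<close>, as it should be.
\<close>

definition ratio :: "'m sched_inst \<Rightarrow> 'm \<Rightarrow> nat \<Rightarrow> real" where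
  "ratio I i j = weight I j / mean I i j"

definition H :: "'m sched_inst \<Rightarrow> nat \<Rightarrow> 'm \<Rightarrow> nat set" where
  "H I j i = {k. k < njobs I \<and> ratio I i k > ratio I i j} \<union>
             {k. k < njobs I \<and> k \<le> j \<and> ratio I i k = ratio I i j}"

definition L :: "'m sched_inst \<Rightarrow> nat \<Rightarrow> 'm \<Rightarrow> nat set" where
  "L I j i = {..<njobs I} - H I j i"

definition mod_release :: "'m sched_inst \<Rightarrow> 'm \<Rightarrow> nat \<Rightarrow> real" where
  "mod_release I i j = max (2 * release I j) (mean I i j)"

text \<open>
  Only the values \<open>a k\<close> with \<open>k < j\<close>, i.e. the assignments made before that of \<open>j\<close>, matter.
\<close>

definition incr :: "'m sched_inst \<Rightarrow> (nat \<Rightarrow> 'm) \<Rightarrow> nat \<Rightarrow> 'm \<Rightarrow> real" where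
  "incr I a j i =
     weight I j * (2 * mod_release I i j +
       (\<Sum>k | (k = j \<or> a k = i) \<and> k \<le> j \<and> k \<in> H I j i. mean I i k)) +
     mean I i j * (\<Sum>k | a k = i \<and> k < j \<and> k \<in> L I j i. weight I k)"

text \<open>
  The increments do not depend on realized processing times, so the assignment of the greedy
  algorithm is deterministic.  Ties are broken arbitrarily.
\<close>

definition greedy_assignment :: "'m sched_inst \<Rightarrow> (nat \<Rightarrow> 'm) \<Rightarrow> bool" where
  "greedy_assignment I a \<longleftrightarrow>
     (\<forall>j<njobs I. can_run I (a j) j \<and>
        (\<forall>i. can_run I i j \<longrightarrow> incr I a j (a j) \<le> incr I a j i))"

definition available :: "'m sched_inst \<Rightarrow> (nat \<Rightarrow> 'm) \<Rightarrow> real \<Rightarrow> 'm obs \<Rightarrow> 'm \<Rightarrow> nat set" where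
  "available I a t Ob i =
     {k. k < njobs I \<and> a k = i \<and> Ob k = None \<and> mod_release I i k \<le> t}"

text \<open>
  If no machine can be committed to a job, the algorithm waits; the tentative decision time is
  the next modified release date among the jobs known so far.  Ties between jobs of equal ratio
  may be broken in any way that depends only on the observations.
\<close>

definition greedy_policy :: "'m sched_inst \<Rightarrow> (nat \<Rightarrow> 'm) \<Rightarrow> 'm policy \<Rightarrow> bool" where
  "greedy_policy I a \<pi> \<longleftrightarrow>
     (\<forall>t Ob.
        if \<exists>i\<in>machines I. idle Ob i \<and> available I a t Ob i \<noteq> {}
        then \<exists>i\<in>machines I. \<exists>k\<in>available I a t Ob i. idle Ob i \<and>
               (\<forall>k'\<in>available I a t Ob i. ratio I i k' \<le> ratio I i k) \<and>
               \<pi> t Ob = Process k i (mean I i k)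
        else \<pi> t Ob = Wait
               (let R = {mod_release I (a k) k |k. k < njobs I \<and> release I k \<le> t \<and>
                           Ob k = None \<and> t < mod_release I (a k) k}
                in if R = {} then None else Some (Min R)))"

end

(*
Write p_k for the mean of job k on its greedy machine, load_k for the total mean of the jobs on that
machine whose ratio is at least that of k, and incr_k for the increment of k.

Upper bound.  Whether k has been committed to its machine by a given time does not depend on the
realized processing time of k.  So the expected work committed to a machine before a job becomes
available equals the expected idle time inserted in front of it, which is at most twice the modified
release date; hence E[C_j] <= 4 r_j + 2 load_j.  Since a pair of jobs on one machine contributes
min (w_j p_k) (w_k p_j) to the increments, greedy costs at most four times the sum of the increments.

Lower bound.  This is a dual fitting argument carried out along each realization of a policy, with
the increments as dual variables of the jobs, and with the total weight of the jobs k of machine i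
with load_k / 4 > t as the dual variable of machine i at time t.  The jobs with load_k / 4 <= t have
total mean at most 4 t, so comparing incr_j with the increment on the machine i that the policy uses
for j gives, for start s and processing time P of j,
  incr_j <= w_j (4 s + 3 E[P] + 4 (s + P)) + E[P] * (dual variable of i at time s + P).
Multiply by P / E[P] and take expectations: s and P are independent, which brings in the second moment
of P and thereby Delta.  Summed over j, the last terms charge job k with the work completed on one
machine by time load_k / 4, which is at most load_k / 4; so they are at most half the sum of the
increments.
*)
theory Submission
  imports Defs
begin

section \<open>Runs of a policy\<close>

lemma run_0 [simp]: "run I \<pi> p 0 = (0, \<lambda>_. None)"
  by (simp add: run_def)

lemma run_Suc: "run I \<pi> p (Suc m) = step I \<pi> p (run I \<pi> p m)"
  by (simp add: run_def)

lemma idle_observe_iff: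
  "idle (observe p t S) i \<longleftrightarrow> (\<forall>j s. S j = Some (i, s) \<longrightarrow> s + real (p j i) \<le> t)"
  unfolding idle_def observe_def by (auto split: if_splits)

lemma observe_eq_None_iff [simp]: "observe p t S j = None \<longleftrightarrow> S j = None"
  by (simp add: observe_def)

declare step.simps [simp del]

lemma step_cases:
  obtains
    (commit) j i d where "j < njobs I" "S j = None" "can_run I i j" "release I j \<le> t"
      "idle (observe p t S) i" "0 \<le> d" "step I \<pi> p (t, S) = (t, S(j \<mapsto> (i, t + d)))"
  | (stay) t' where "step I \<pi> p (t, S) = (t', S)"
proof (cases "\<pi> t (observe p t S)")
  case (Process j i d)
  then show ?thesis
    using commit[of j i d] stay by (cases "j < njobs I \<and> S j = None \<and> can_run I i j \<and> release I j \<le> t \<and>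
      idle (observe p t S) i \<and> 0 \<le> d") (simp_all add: step.simps)
next
  case (Wait \<tau>)
  then show ?thesis
    using stay by (simp add: step.simps Let_def)
qed

lemma step_preserves_commitment:
  assumes "S j = Some x"
  shows "snd (step I \<pi> p (t, S)) j = Some x"
  by (rule step_cases[of I S t p \<pi>]) (use assms in auto)

lemma run_preserves_commitment:
  assumes "snd (run I \<pi> p m) j = Some x" "m \<le> m'"
  shows "snd (run I \<pi> p m') j = Some x"
  using assms(2)
proof (induction rule: dec_induct)
  case (step k)
  then show ?case
    using step_preserves_commitment[of "snd (run I \<pi> p k)" j x I \<pi> p "fst (run I \<pi> p k)"]
    by (simp add: run_Suc)
qed (use assms in simp)

text \<open>A step that does not commit leaves the schedule alone, so a property of the schedule
  need only survive commitments, whatever the current time.\<close>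

lemma run_schedule_induct:
  assumes "P (\<lambda>_. None)"
    and "\<And>t S j i d. P S \<Longrightarrow> j < njobs I \<Longrightarrow> S j = None \<Longrightarrow> can_run I i j \<Longrightarrow> release I j \<le> t \<Longrightarrow>
      (\<And>k s. S k = Some (i, s) \<Longrightarrow> s + real (p k i) \<le> t) \<Longrightarrow> 0 \<le> d \<Longrightarrow> P (S(j \<mapsto> (i, t + d)))"
  shows "P (snd (run I \<pi> p m))"
proof (induction m)
  case (Suc m)
  obtain t S where tS: "run I \<pi> p m = (t, S)"
    by fastforce
  show ?case
    by (rule step_cases[of I S t p \<pi>])
      (use Suc tS assms(2)[of S] in \<open>auto simp: run_Suc idle_observe_iff simp del: fun_upd_apply\<close>)
qed (use assms in simp)

text \<open>Commitments are permanent, so the entry at the first stage where it is set is the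
  eventual one. If it is never set, \<open>LEAST\<close> is unspecified, but every stage then gives
  \<open>None\<close>.\<close>

definition final_schedule :: "'m sched_inst \<Rightarrow> 'm policy \<Rightarrow> 'm realization \<Rightarrow> 'm schedule" where
  "final_schedule I \<pi> p j =
     snd (run I \<pi> p (LEAST m. snd (run I \<pi> p m) j \<noteq> None)) j"

lemma final_schedule_eqI:
  assumes "snd (run I \<pi> p m) j = Some x"
  shows "final_schedule I \<pi> p j = Some x"
proof -
  let ?l = "LEAST m. snd (run I \<pi> p m) j \<noteq> None"
  have "snd (run I \<pi> p ?l) j \<noteq> None" "?l \<le> m"
    using assms LeastI[of "\<lambda>m. snd (run I \<pi> p m) j \<noteq> None" m]
    by (auto intro!: Least_le)
  then show ?thesis
    using run_preserves_commitment[of I \<pi> p ?l j _ m] assms by (auto simp: final_schedule_def)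
qed

lemma completion_eq:
  "completion I \<pi> p j =
     (case final_schedule I \<pi> p j of None \<Rightarrow> \<infinity> | Some (i, s) \<Rightarrow> ennreal (s + real (p j i)))"
proof (cases "final_schedule I \<pi> p j")
  case None
  then have "{(i, s). \<exists>m. snd (run I \<pi> p m) j = Some (i, s)} = {}"
    using final_schedule_eqI by fastforce
  then show ?thesis
    unfolding completion_def using None by (simp only:) (simp add: top_ennreal_def)
next
  case (Some x)
  then have "(\<exists>m. snd (run I \<pi> p m) j = Some y) \<longleftrightarrow> y = x" for y
    using final_schedule_eqI[of I \<pi> p _ j y] unfolding final_schedule_def by auto
  then have "{(i, s). \<exists>m. snd (run I \<pi> p m) j = Some (i, s)} = {x}"
    by auto
  then show ?thesis
    unfolding completion_def using Some by (simp only:) (simp split: prod.splits)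
qed

text \<open>Finitely many jobs are all committed by a common stage; this transfers invariants of
  finite runs to \<open>final_schedule\<close>.\<close>

lemma final_schedule_reached:
  assumes "\<And>j. j < njobs I \<Longrightarrow> final_schedule I \<pi> p j \<noteq> None"
  obtains m where "\<And>j. j < njobs I \<Longrightarrow> snd (run I \<pi> p m) j = final_schedule I \<pi> p j"
proof -
  define l where "l j = (LEAST m. snd (run I \<pi> p m) j \<noteq> None)" for j
  have "snd (run I \<pi> p (Max (l ` {..<njobs I}))) j = final_schedule I \<pi> p j" if j: "j < njobs I" for j
  proof -
    obtain x where "snd (run I \<pi> p (l j)) j = Some x"
      using assms[OF j] by (auto simp: final_schedule_def l_def)
    moreover have "l j \<le> Max (l ` {..<njobs I})"
      using j by simp
    ultimately show ?thesis
      using run_preserves_commitment[of I \<pi> p "l j" j x] final_schedule_eqI[of I \<pi> p "l j" j x] by simp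
  qed
  then show ?thesis
    using that by blast
qed

section \<open>Non-anticipation\<close>

lemma step_fun_upd_uncommitted:
  assumes "S j = None"
  shows "step I \<pi> (p(j := v)) (t, S) = step I \<pi> p (t, S)"
proof -
  have "observe (p(j := v)) t S = observe p t S"
    using assms by (auto simp: observe_def fun_eq_iff intro!: arg_cong2[where f = map_option])
  moreover have "{s + real ((p(j := v)) k i) |k i s. S k = Some (i, s)} =
      {s + real (p k i) |k i s. S k = Some (i, s)}"
    using assms by (intro Collect_cong) (metis fun_upd_other option.distinct(1))
  ultimately show ?thesis
    by (simp only: step.simps)
qed

text \<open>Non-anticipation: a step consults the processing time of \<open>j\<close> only once
  \<open>j\<close> is committed, and from then on the entry of \<open>j\<close> is frozen.\<close>

lemma final_schedule_fun_upd_self: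
  "final_schedule I \<pi> (p(j := v)) j = final_schedule I \<pi> p j"
proof -
  \<comment> \<open>Whole states agree only as long as \<open>j\<close> is uncommitted; later
    decisions may differ, so from then on only the entry of \<open>j\<close> is tracked.\<close>
  have "snd (run I \<pi> (p(j := v)) m) j = snd (run I \<pi> p m) j \<and>
      (snd (run I \<pi> p m) j = None \<longrightarrow> run I \<pi> (p(j := v)) m = run I \<pi> p m)" for m
  proof (induction m)
    case (Suc m)
    show ?case
    proof (cases "snd (run I \<pi> p m) j")
      case None
      with Suc have "run I \<pi> (p(j := v)) m = run I \<pi> p m"
        by blast
      then have "run I \<pi> (p(j := v)) (Suc m) = run I \<pi> p (Suc m)"
        using step_fun_upd_uncommitted[of "snd (run I \<pi> p m)" j I \<pi> p v "fst (run I \<pi> p m)"] None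
        by (simp add: run_Suc)
      then show ?thesis
        by (simp del: fun_upd_apply)
    next
      case (Some x)
      with Suc show ?thesis
        using run_preserves_commitment[of I \<pi> _ m j x "Suc m"] by simp
    qed
  qed simp
  then show ?thesis
    by (simp add: final_schedule_def)
qed

lemma nn_integral_realizations_split:
  assumes "j < njobs I"
  shows "(\<integral>\<^sup>+p. G p \<partial>measure_pmf (realizations I)) =
    (\<integral>\<^sup>+q. \<integral>\<^sup>+v. G (q(j := v)) \<partial>measure_pmf (law I j)
       \<partial>measure_pmf (Pi_pmf ({..<njobs I} - {j}) (\<lambda>_. 0) (law I)))"
proof -
  let ?Q = "Pi_pmf ({..<njobs I} - {j}) (\<lambda>_. 0) (law I)"
  have "realizations I = map_pmf (\<lambda>(v, q). q(j := v)) (pair_pmf (law I j) ?Q)"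
    using Pi_pmf_insert[of "{..<njobs I} - {j}" j "\<lambda>_. 0" "law I"] assms
    by (simp add: realizations_def insert_absorb)
  also have "\<dots> = map_pmf (\<lambda>(q, v). q(j := v)) (pair_pmf ?Q (law I j))"
    by (subst pair_commute_pmf) (simp add: map_pmf_comp case_prod_unfold)
  finally show ?thesis
    by (simp add: nn_integral_pair_pmf' case_prod_unfold)
qed

text \<open>Since \<open>X\<close> ignores the processing times of \<open>j\<close>, these may be
  redrawn from their law independently of \<open>X\<close>: independence in the form of
  Fubini.\<close>

lemma nn_integral_realizations_resample:
  assumes "j < njobs I" "\<And>p v. X (p(j := v)) = X p"
  shows "(\<integral>\<^sup>+p. F (X p) (p j) \<partial>measure_pmf (realizations I)) =
    (\<integral>\<^sup>+p. \<integral>\<^sup>+v. F (X p) v \<partial>measure_pmf (law I j) \<partial>measure_pmf (realizations I))"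
  by (simp add: nn_integral_realizations_split[OF assms(1)] assms(2))

lemma nn_integral_realizations_final_schedule:
  assumes "j < njobs I"
  shows "(\<integral>\<^sup>+p. F (final_schedule I \<pi> p j) (p j) \<partial>measure_pmf (realizations I)) =
    (\<integral>\<^sup>+p. \<integral>\<^sup>+v. F (final_schedule I \<pi> p j) v \<partial>measure_pmf (law I j)
       \<partial>measure_pmf (realizations I))"
  by (rule nn_integral_realizations_resample[where X = "\<lambda>p. final_schedule I \<pi> p j"])
    (use assms in \<open>auto simp: final_schedule_fun_upd_self\<close>)

section \<open>Feasibility of schedules\<close>

lemma run_commitment_admissible:
  assumes "snd (run I \<pi> p m) j = Some (i, s)"
  shows "j < njobs I" "can_run I i j" "release I j \<le> s"
proof -
  have "\<forall>j i s. snd (run I \<pi> p m) j = Some (i, s) \<longrightarrow> j < njobs I \<and> can_run I i j \<and> release I j \<le> s"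
    by (rule run_schedule_induct) (auto split: if_splits)
  with assms show "j < njobs I" "can_run I i j" "release I j \<le> s"
    by blast+
qed

lemma final_schedule_admissible:
  assumes "final_schedule I \<pi> p j = Some (i, s)"
  shows "j < njobs I" "can_run I i j" "release I j \<le> s"
  using run_commitment_admissible assms by (auto simp: final_schedule_def)

text \<open>Processing intervals on one machine are disjoint, so those inside the first
  \<open>T\<close> time units have total length at most \<open>T\<close>. By induction over
  commitments: the earlier jobs of the machine are done by the commitment time, and a new job that
  ends by \<open>T\<close> fits between that time and \<open>T\<close>.\<close>

lemma run_completed_work_le:
  assumes "valid_inst I" "0 \<le> T"
  shows "(\<Sum>j | \<exists>s. snd (run I \<pi> p m) j = Some (i, s) \<and> s + real (p j i) \<le> T. real (p j i)) \<le> T"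
proof -
  define D where "D S T = {j. \<exists>s. S j = Some (i, s) \<and> s + real (p j i) \<le> T}"
    for S :: "'a schedule" and T
  \<comment> \<open>The bound is kept for all thresholds at once, since the step for
    \<open>T\<close> uses it at the commitment time.\<close>
  let ?P = "\<lambda>S. finite (dom S) \<and> (\<forall>T\<ge>0. (\<Sum>j\<in>D S T. real (p j i)) \<le> T)"
  have "?P (snd (run I \<pi> p m))"
  proof (rule run_schedule_induct, goal_cases)
    case 1
    then show ?case
      by (simp add: D_def)
  next
    case (2 t S j i' d)
    have fin: "finite (D S T)" for T
      using 2(1) by (auto simp: D_def elim!: finite_subset[rotated])
    have t: "0 \<le> t"
      using assms(1) 2(2,5) by (force simp: valid_inst_def)
    have "(\<Sum>k\<in>D (S(j \<mapsto> (i', t + d))) T. real (p k i)) \<le> T" if T: "0 \<le> T" for T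
    proof (cases "i' = i \<and> t + d + real (p j i) \<le> T")
      case True
      then have "D (S(j \<mapsto> (i', t + d))) T = insert j (D S T)"
        using 2(3) by (auto simp: D_def)
      moreover have "j \<notin> D S T"
        using 2(3) by (simp add: D_def)
      moreover have "D S T \<subseteq> D S t"
        using 2(6) True by (auto simp: D_def)
      then have "(\<Sum>k\<in>D S T. real (p k i)) \<le> (\<Sum>k\<in>D S t. real (p k i))"
        using fin by (intro sum_mono2) auto
      then have "(\<Sum>k\<in>D S T. real (p k i)) \<le> t"
        using 2(1) t by force
      ultimately show ?thesis
        using fin True 2(7) by simp
    next
      case False
      then have "D (S(j \<mapsto> (i', t + d))) T = D S T"
        using 2(3) by (auto simp: D_def)
      then show ?thesis
        using 2(1) T by simp
    qed
    then show ?case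
      using 2(1) by (simp del: fun_upd_apply)
  qed
  then show ?thesis
    using assms(2) by (simp add: D_def)
qed

section \<open>The increments\<close>

lemma weight_nonneg: "valid_inst I \<Longrightarrow> j < njobs I \<Longrightarrow> 0 \<le> weight I j"
  by (simp add: valid_inst_def)

lemma mean_pos:
  assumes "valid_inst I" "j < njobs I" "can_run I i j"
  shows "0 < mean I i j"
  using assms by (auto simp: valid_inst_def can_run_def mean_def enn2real_positive_iff)

lemma mean_nonneg [simp]: "0 \<le> mean I i j"
  by (simp add: mean_def)

lemma ennreal_mean: "can_run I i j \<Longrightarrow> ennreal (mean I i j) = EP I i j"
  by (simp add: mean_def can_run_def)

lemma ratio_le_iff:
  assumes "valid_inst I" "j < njobs I" "can_run I i j" "k < njobs I" "can_run I i k"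
  shows "ratio I i j \<le> ratio I i k \<longleftrightarrow> weight I j * mean I i k \<le> weight I k * mean I i j"
  using mean_pos[OF assms(1-3)] mean_pos[OF assms(1,4,5)]
  by (simp add: ratio_def divide_simps)

text \<open>For an earlier job \<open>k\<close> on \<open>i\<close>, membership in \<open>H\<close>
  says exactly that \<open>weight I j * mean I i k\<close> is at most the other product. So the two
  sums of \<open>incr\<close> merge into one whose terms are symmetric in the pair.\<close>

lemma incr_eq:
  assumes "valid_inst I" "j < njobs I" "can_run I i j"
    and a: "\<And>k. k < j \<Longrightarrow> can_run I (a k) k"
  shows "incr I a j i = weight I j * (2 * mod_release I i j + mean I i j) +
    (\<Sum>k | k < j \<and> a k = i. min (weight I j * mean I i k) (weight I k * mean I i j))"
proof -
  let ?A = "{k. a k = i \<and> k < j \<and> k \<in> H I j i}"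
  let ?B = "{k. a k = i \<and> k < j \<and> k \<in> L I j i}"
  let ?m = "\<lambda>k. min (weight I j * mean I i k) (weight I k * mean I i j)"
  have j: "j \<in> H I j i"
    using assms(2) by (simp add: H_def)
  have le: "k \<in> H I j i \<longleftrightarrow> weight I j * mean I i k \<le> weight I k * mean I i j"
    if "k < j" "a k = i" for k
    using ratio_le_iff[OF assms(1-3), of k] that a[of k] assms(2) by (auto simp: H_def)
  have "{k. (k = j \<or> a k = i) \<and> k \<le> j \<and> k \<in> H I j i} = insert j ?A"
    using j by auto
  then have "incr I a j i = weight I j * (2 * mod_release I i j + mean I i j) +
     ((\<Sum>k\<in>?A. weight I j * mean I i k) + (\<Sum>k\<in>?B. weight I k * mean I i j))"
    by (simp add: incr_def sum_distrib_left sum_distrib_right algebra_simps)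
  also have "(\<Sum>k\<in>?A. weight I j * mean I i k) = (\<Sum>k\<in>?A. ?m k)"
    using le by (intro sum.cong) auto
  also have "(\<Sum>k\<in>?B. weight I k * mean I i j) = (\<Sum>k\<in>?B. ?m k)"
    using le by (intro sum.cong) (auto simp: L_def)
  also have "(\<Sum>k\<in>?A. ?m k) + (\<Sum>k\<in>?B. ?m k) = (\<Sum>k\<in>?A \<union> ?B. ?m k)"
    by (rule sum.union_disjoint[symmetric]) (auto simp: L_def)
  also have "?A \<union> ?B = {k. k < j \<and> a k = i}"
    using assms(2) by (auto simp: L_def)
  finally show ?thesis .
qed

lemma incr_nonneg:
  assumes "valid_inst I" "j < njobs I"
  shows "0 \<le> incr I a j i"
  unfolding incr_def
  by (intro add_nonneg_nonneg mult_nonneg_nonneg sum_nonneg)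
    (use assms in \<open>auto simp: weight_nonneg mod_release_def le_max_iff_disj\<close>)

text \<open>Ties count in both directions, unlike in \<open>H\<close>, because the policy may break
  them arbitrarily.\<close>

definition precedence :: "'m sched_inst \<Rightarrow> (nat \<Rightarrow> 'm) \<Rightarrow> nat \<Rightarrow> nat set" where
  "precedence I a j =
     {k. k < njobs I \<and> a k = a j \<and> ratio I (a j) j \<le> ratio I (a j) k}"

lemma finite_precedence [simp]: "finite (precedence I a j)"
  by (simp add: precedence_def)

definition load :: "'m sched_inst \<Rightarrow> (nat \<Rightarrow> 'm) \<Rightarrow> nat \<Rightarrow> real" where
  "load I a j = (\<Sum>k\<in>precedence I a j. mean I (a j) k)"

lemma load_nonneg [simp]: "0 \<le> load I a j"
  by (simp add: load_def sum_nonneg)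

lemma sum_off_diagonal_symmetric:
  fixes g :: "nat \<Rightarrow> nat \<Rightarrow> 'a :: comm_semiring_1"
  assumes "\<And>j k. g j k = g k j"
  shows "(\<Sum>j<n. \<Sum>k\<in>{..<n} - {j}. g j k) = 2 * (\<Sum>j<n. \<Sum>k<j. g j k)"
proof (induction n)
  case (Suc n)
  have "(\<Sum>k\<in>{..<Suc n} - {j}. g j k) = g n j + (\<Sum>k\<in>{..<n} - {j}. g j k)" if "j < n" for j
  proof -
    have "{..<Suc n} - {j} = insert n ({..<n} - {j})"
      using that by auto
    then show ?thesis
      using assms[of n j] by simp
  qed
  moreover have "{..<Suc n} - {n} = {..<n}"
    by auto
  ultimately show ?case
    using Suc by (simp add: sum.distrib mult_2 ac_simps)
qed simp

text \<open>Each pair on one machine enters the increments once, with its minimum. It enters the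
  weighted loads with the same value once, or twice if the ratios are equal, which costs the factor
  2.\<close>

lemma weighted_load_le_incr:
  assumes "valid_inst I" and run: "\<And>j. j < njobs I \<Longrightarrow> can_run I (a j) j"
  shows "(\<Sum>j<njobs I. weight I j * (2 * mod_release I (a j) j + load I a j)) \<le>
    2 * (\<Sum>j<njobs I. incr I a j (a j))"
proof -
  let ?n = "njobs I"
  define g where "g j k = (if a k = a j then
    min (weight I j * mean I (a k) k) (weight I k * mean I (a j) j) else 0)" for j k
  have w: "0 \<le> weight I j" if "j < ?n" for j
    using assms(1) that by (simp add: valid_inst_def)
  have r: "0 \<le> mod_release I i j" for i j
    by (simp add: mod_release_def le_max_iff_disj)
  have incr: "incr I a j (a j) = weight I j * (2 * mod_release I (a j) j + mean I (a j) j) +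
      (\<Sum>k<j. g j k)" if "j < ?n" for j
  proof -
    have "(\<Sum>k<j. g j k) = (\<Sum>k | k < j \<and> a k = a j. g j k)"
      by (rule sum.mono_neutral_right) (auto simp: g_def)
    then show ?thesis
      using incr_eq[OF assms(1) that run[OF that], of a] run that
      by (auto simp: g_def intro!: sum.cong)
  qed
  have "weight I j * load I a j \<le> weight I j * mean I (a j) j + (\<Sum>k\<in>{..<?n} - {j}. g j k)"
    if j: "j < ?n" for j
  proof -
    have "weight I j * load I a j = (\<Sum>k\<in>precedence I a j. weight I j * mean I (a j) k)"
      by (simp add: load_def sum_distrib_left)
    also have "\<dots> = weight I j * mean I (a j) j +
        (\<Sum>k\<in>precedence I a j - {j}. weight I j * mean I (a j) k)"
      using j by (intro sum.remove) (auto simp: precedence_def)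
    also have "(\<Sum>k\<in>precedence I a j - {j}. weight I j * mean I (a j) k) =
        (\<Sum>k\<in>precedence I a j - {j}. g j k)"
    proof (intro sum.cong refl)
      fix k assume "k \<in> precedence I a j - {j}"
      then show "weight I j * mean I (a j) k = g j k"
        using ratio_le_iff[OF assms(1) j run[OF j], of k] run[of k]
        by (auto simp: precedence_def g_def)
    qed
    also have "\<dots> \<le> (\<Sum>k\<in>{..<?n} - {j}. g j k)"
      using w j by (intro sum_mono2) (auto simp: precedence_def g_def)
    finally show ?thesis
      by simp
  qed
  then have "(\<Sum>j<?n. weight I j * load I a j) \<le>
      (\<Sum>j<?n. weight I j * mean I (a j) j + (\<Sum>k\<in>{..<?n} - {j}. g j k))"
    by (intro sum_mono) simp
  also have "\<dots> = (\<Sum>j<?n. weight I j * mean I (a j) j) + (\<Sum>j<?n. \<Sum>k\<in>{..<?n} - {j}. g j k)"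
    by (simp add: sum.distrib)
  also have "(\<Sum>j<?n. \<Sum>k\<in>{..<?n} - {j}. g j k) = 2 * (\<Sum>j<?n. \<Sum>k<j. g j k)"
    by (rule sum_off_diagonal_symmetric) (simp add: g_def min.commute)
  finally have "(\<Sum>j<?n. weight I j * load I a j) \<le>
      (\<Sum>j<?n. weight I j * mean I (a j) j) + 2 * (\<Sum>j<?n. \<Sum>k<j. g j k)" .
  moreover have "(\<Sum>j<?n. incr I a j (a j)) = 2 * (\<Sum>j<?n. weight I j * mod_release I (a j) j) +
      (\<Sum>j<?n. weight I j * mean I (a j) j) + (\<Sum>j<?n. \<Sum>k<j. g j k)"
    using incr by (simp add: sum.distrib sum_distrib_left distrib_left mult.left_commute)
  moreover have "(\<Sum>j<?n. weight I j * (2 * mod_release I (a j) j + load I a j)) =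
      2 * (\<Sum>j<?n. weight I j * mod_release I (a j) j) + (\<Sum>j<?n. weight I j * load I a j)"
    by (simp add: sum.distrib sum_distrib_left distrib_left mult.left_commute)
  moreover have "0 \<le> (\<Sum>j<?n. weight I j * mod_release I (a j) j)"
    "0 \<le> (\<Sum>j<?n. weight I j * mean I (a j) j)"
    using w r by (auto intro!: sum_nonneg)
  ultimately show ?thesis
    by linarith
qed

text \<open>The dual constraint, to be used with \<open>s\<close> the start and \<open>T\<close> the
  completion time of \<open>j\<close> under another policy. The jobs on \<open>i\<close> are split
  by \<open>load I a k / 4\<close>: those up to \<open>T\<close> have small total mean and are
  charged to the weight of \<open>j\<close>, the others are charged to the mean of
  \<open>j\<close>.\<close>

lemma greedy_incr_le:
  assumes "valid_inst I" "greedy_assignment I a" and j: "j < njobs I" "can_run I i j"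
    and s: "release I j \<le> s" and T: "0 \<le> T"
  shows "incr I a j (a j) \<le> weight I j * (4 * s + 3 * mean I i j + 4 * T) +
    mean I i j * (\<Sum>k | k < njobs I \<and> a k = i \<and> T < load I a k / 4. weight I k)"
proof -
  let ?n = "njobs I" and ?p = "mean I i j"
  let ?D = "{k. k < ?n \<and> a k = i \<and> load I a k / 4 \<le> T}"
  let ?U = "{k. k < ?n \<and> a k = i \<and> T < load I a k / 4}"
  let ?m = "\<lambda>k. min (weight I j * mean I i k) (weight I k * ?p)"
  have w: "0 \<le> weight I k" if "k < ?n" for k
    using assms(1) that by (simp add: valid_inst_def)
  have run: "can_run I (a k) k" if "k < ?n" for k
    using assms(2) that by (simp add: greedy_assignment_def)
  have D: "(\<Sum>k\<in>?D. mean I i k) \<le> 4 * T"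
  proof (cases "?D = {}")
    case True
    show ?thesis
      unfolding True using T by simp
  next
    case False
    have "finite ?D"
      by simp
    \<comment> \<open>The member of smallest ratio has the whole set in its precedence set, so its
      load, which is at most \<open>4 * T\<close>, bounds the total mean.\<close>
    then obtain k where k: "k \<in> ?D" "\<And>l. l \<in> ?D \<Longrightarrow> ratio I i k \<le> ratio I i l"
      using arg_min_least[of ?D _ "ratio I i"] arg_min_if_finite(1)[of ?D "ratio I i"] False
      by blast
    have "?D \<subseteq> precedence I a k" "a k = i"
      using k by (force simp: precedence_def)+
    then have "(\<Sum>k\<in>?D. mean I i k) \<le> load I a k"
      unfolding load_def by (auto intro: sum_mono2)
    then show ?thesis
      using k(1) by simp
  qed
  have "incr I a j (a j) \<le> incr I a j i"
    using assms(2) j by (simp add: greedy_assignment_def)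
  also have "incr I a j i = weight I j * (2 * mod_release I i j + ?p) +
      (\<Sum>k | k < j \<and> a k = i. ?m k)"
    using run j by (intro incr_eq[OF assms(1) j]) simp
  also have "(\<Sum>k | k < j \<and> a k = i. ?m k) \<le> (\<Sum>k\<in>?D \<union> ?U. ?m k)"
    using w j(1) by (intro sum_mono2) auto
  also have "(\<Sum>k\<in>?D \<union> ?U. ?m k) = (\<Sum>k\<in>?D. ?m k) + (\<Sum>k\<in>?U. ?m k)"
    by (rule sum.union_disjoint) auto
  also have "\<dots> \<le> (\<Sum>k\<in>?D. weight I j * mean I i k) + (\<Sum>k\<in>?U. ?p * weight I k)"
    by (intro add_mono sum_mono) (auto simp: mult.commute)
  also have "\<dots> = weight I j * (\<Sum>k\<in>?D. mean I i k) + ?p * (\<Sum>k\<in>?U. weight I k)"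
    by (simp add: sum_distrib_left)
  also have "weight I j * (\<Sum>k\<in>?D. mean I i k) \<le> weight I j * (4 * T)"
    by (rule mult_left_mono[OF D w[OF j(1)]])
  also have "weight I j * (2 * mod_release I i j + ?p) \<le> weight I j * (4 * s + 3 * ?p)"
  proof -
    have "0 \<le> release I j"
      using assms(1) j(1) by (simp add: valid_inst_def)
    \<comment> \<open>The maximum is bounded by the sum of its arguments.\<close>
    then have "mod_release I i j \<le> 2 * s + ?p"
      using s by (simp add: mod_release_def add_increasing add_increasing2)
    then show ?thesis
      by (intro mult_left_mono w j(1)) linarith
  qed
  finally show ?thesis
    by (simp add: algebra_simps)
qed

section \<open>The greedy schedule\<close>

context
  fixes I :: "'m sched_inst" and a :: "nat \<Rightarrow> 'm" and \<pi> :: "'m policy" and p :: "'m realization"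
  assumes valid: "valid_inst I" and assignment: "greedy_assignment I a"
    and greedy: "greedy_policy I a \<pi>"
begin

section \<open>Single steps of a greedy run\<close>

private abbreviation "n \<equiv> njobs I"
private abbreviation "mr j \<equiv> mod_release I (a j) j"
private abbreviation "\<mu> j \<equiv> mean I (a j) j"

text \<open>The times from which \<open>step\<close> chooses when the greedy policy waits, with its
  tentative decision time spelled out.\<close>

private definition events :: "real \<times> 'm schedule \<Rightarrow> real set" where
  "events = (\<lambda>(t, S). {u \<in> set_option
     (let R = {mr k |k. k < n \<and> release I k \<le> t \<and> S k = None \<and> t < mr k}
      in if R = {} then None else Some (Min R)) \<union> release I ` {..<n} \<union>
     {s + real (p j i) |j i s. S j = Some (i, s)}. t < u})"

private lemma greedy_can_run: "j < n \<Longrightarrow> can_run I (a j) j"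
  using assignment by (simp add: greedy_assignment_def)

private lemma release_nonneg: "j < n \<Longrightarrow> 0 \<le> release I j"
  using valid by (simp add: valid_inst_def)

private lemma release_le_mod_release: "j < n \<Longrightarrow> release I j \<le> mr j"
  using release_nonneg[of j] by (simp add: mod_release_def le_max_iff_disj)

private lemma mean_le_mod_release: "\<mu> j \<le> mr j"
  by (simp add: mod_release_def)

private lemma mod_release_nonneg: "0 \<le> mr j"
  by (simp add: mod_release_def le_max_iff_disj)

text \<open>The commitment chosen by the policy is always admissible, since modified release dates
  are at least the release dates. When it waits, every available job has a busy machine, where the
  inserted idle time counts as busy too.\<close>

private lemma greedy_step_cases:
  obtains
    (commit) k where "k < n" "S k = None" "mr k \<le> t"
      "\<And>j s. S j = Some (a k, s) \<Longrightarrow> s + real (p j (a k)) \<le> t"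
      "\<And>j. j < n \<Longrightarrow> a j = a k \<Longrightarrow> S j = None \<Longrightarrow> mr j \<le> t \<Longrightarrow> ratio I (a k) j \<le> ratio I (a k) k"
      "step I \<pi> p (t, S) = (t, S(k \<mapsto> (a k, t + \<mu> k)))"
  | (wait) "\<And>j. j < n \<Longrightarrow> S j = None \<Longrightarrow> mr j \<le> t \<Longrightarrow>
        \<exists>k s. S k = Some (a j, s) \<and> t < s + real (p k (a j))"
      "step I \<pi> p (t, S) = (if events (t, S) = {} then t else Min (events (t, S)), S)"
proof (cases "\<exists>i\<in>machines I. idle (observe p t S) i \<and> available I a t (observe p t S) i \<noteq> {}")
  case True
  then obtain i k where k: "i \<in> machines I" "k \<in> available I a t (observe p t S) i"
      "idle (observe p t S) i"
      "\<And>k'. k' \<in> available I a t (observe p t S) i \<Longrightarrow> ratio I i k' \<le> ratio I i k"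
      "\<pi> t (observe p t S) = Process k i (mean I i k)"
    using greedy[unfolded greedy_policy_def, THEN spec[of _ t], THEN spec[of _ "observe p t S"]] by auto
  have k': "k < n" "a k = i" "S k = None" "mr k \<le> t"
    using k(2) by (auto simp: available_def)
  have "step I \<pi> p (t, S) = (t, S(k \<mapsto> (a k, t + \<mu> k)))"
    using k' k(3,5) greedy_can_run[of k] release_le_mod_release[of k] by (simp add: step.simps)
  with k k' show ?thesis
    by (intro commit[of k]) (auto simp: idle_observe_iff available_def)
next
  case False
  have "\<exists>k s. S k = Some (a j, s) \<and> t < s + real (p k (a j))"
    if "j < n" "S j = None" "mr j \<le> t" for j
  proof -
    have "a j \<in> machines I"
      using greedy_can_run[OF that(1)] by (simp add: can_run_def)
    moreover have "j \<in> available I a t (observe p t S) (a j)"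
      using that by (simp add: available_def)
    ultimately have "\<not> idle (observe p t S) (a j)"
      using False by blast
    then show ?thesis
      by (auto simp: idle_observe_iff not_le)
  qed
  moreover have "\<pi> t (observe p t S) = Wait
      (let R = {mr k |k. k < n \<and> release I k \<le> t \<and> S k = None \<and> t < mr k}
       in if R = {} then None else Some (Min R))"
    using greedy[unfolded greedy_policy_def, THEN spec[of _ t], THEN spec[of _ "observe p t S"]] False
    by (simp only: if_False observe_eq_None_iff)
  then have "step I \<pi> p (t, S) = (if events (t, S) = {} then t else Min (events (t, S)), S)"
    by (simp only: step.simps action.case events_def prod.case Let_def)
  ultimately show ?thesis
    by (rule wait)
qed

private lemma finite_events:
  assumes "dom S \<subseteq> {..<n}"
  shows "finite (events (t, S))"
proof -
  have "{s + real (p j i) |j i s. S j = Some (i, s)} =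
      (\<lambda>j. snd (the (S j)) + real (p j (fst (the (S j))))) ` dom S"
    by force
  then have "finite {s + real (p j i) |j i s. S j = Some (i, s)}"
    using finite_subset[OF assms] by simp
  then show ?thesis
    by (simp add: events_def)
qed

text \<open>While job \<open>j\<close> is uncommitted, waiting never runs past its modified release date: before its
  release date the release is an event, and afterwards the tentative decision time is.\<close>

private lemma event_before_mod_release:
  assumes "j < n" "S j = None" "t < mr j"
  shows "\<exists>u\<in>events (t, S). u \<le> mr j"
proof (cases "release I j \<le> t")
  case True
  let ?R = "{mr k |k. k < n \<and> release I k \<le> t \<and> S k = None \<and> t < mr k}"
  have R: "finite ?R" "mr j \<in> ?R"
    using assms True by auto
  then have "Min ?R \<in> ?R"
    by (intro Min_in) auto
  then have "t < Min ?R"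
    by auto
  then have "Min ?R \<in> events (t, S)"
    using R(2) by (auto simp: events_def Let_def)
  then show ?thesis
    using Min_le[OF R] by blast
next
  case False
  then have "release I j \<in> events (t, S)"
    using assms by (auto simp: events_def)
  then show ?thesis
    using release_le_mod_release[OF assms(1)] by blast
qed

private lemma completion_event:
  assumes "S k = Some (i, s)" "t < s + real (p k i)"
  shows "s + real (p k i) \<in> events (t, S)"
  using assms by (auto simp: events_def)

text \<open>Bounds the time at which \<open>j\<close> is committed, given the commitments made before: a block that
  covers the modified release date \<open>r\<close> of \<open>j\<close> consists of at most \<open>r\<close> units of idle time before its
  start and of a processing time accounted for in the first sum, and each later block is one of a
  job preceding \<open>j\<close>.\<close>

private definition commit_bound :: "'m schedule \<Rightarrow> nat \<Rightarrow> real" where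
  "commit_bound S j = 2 * mr j +
     (\<Sum>k | k < n \<and> (\<exists>s. S k = Some (a j, s) \<and> s - mean I (a j) k < mr j). real (p k (a j))) +
     (\<Sum>k | k \<in> precedence I a j - {j} \<and> S k \<noteq> None. mean I (a j) k + real (p k (a j)))"

private lemma commit_bound_mono:
  assumes "\<And>k x. S k = Some x \<Longrightarrow> S' k = Some x"
  shows "commit_bound S j \<le> commit_bound S' j"
  unfolding commit_bound_def using assms by (intro add_mono order_refl sum_mono2) fastforce+

text \<open>In order: commitments follow the assignment and respect modified release dates; the idle
  periods inserted on a machine before starts up to \<open>T\<close> are disjoint and so total at
  most \<open>T\<close>; for an uncommitted job, its bound covers the current time and all
  completions already fixed on its machine; a committed job starts at most its own mean after its
  bound.\<close>

private definition greedy_inv :: "real \<Rightarrow> 'm schedule \<Rightarrow> bool" where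
  "greedy_inv t S \<longleftrightarrow>
     (\<forall>k i s. S k = Some (i, s) \<longrightarrow> k < n \<and> i = a k \<and> mr k \<le> s - \<mu> k) \<and>
     (\<forall>i T. 0 \<le> T \<longrightarrow> (\<Sum>k | \<exists>s. S k = Some (i, s) \<and> s \<le> T. mean I i k) \<le> T) \<and>
     (\<forall>j<n. S j = None \<longrightarrow> t \<le> commit_bound S j \<and>
        (\<forall>k s. S k = Some (a j, s) \<longrightarrow> s + real (p k (a j)) \<le> commit_bound S j)) \<and>
     (\<forall>j i s. S j = Some (i, s) \<longrightarrow> s \<le> commit_bound S j + \<mu> j)"

private lemma greedy_inv_commitment:
  assumes "greedy_inv t S" "S k = Some (i, s)"
  shows "k < n \<and> i = a k \<and> mr k \<le> s - \<mu> k"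
  using assms unfolding greedy_inv_def by blast

private lemma greedy_inv_dom: "greedy_inv t S \<Longrightarrow> dom S \<subseteq> {..<n}"
  by (fastforce simp: greedy_inv_def)

private lemma commit_bound_ge: "mr j \<le> commit_bound S j"
proof -
  have "0 \<le> mr j + (\<Sum>k | k < n \<and> (\<exists>s. S k = Some (a j, s) \<and> s - mean I (a j) k < mr j). real (p k (a j))) +
     (\<Sum>k | k \<in> precedence I a j - {j} \<and> S k \<noteq> None. mean I (a j) k + real (p k (a j)))"
    by (intro add_nonneg_nonneg sum_nonneg mod_release_nonneg) auto
  then show ?thesis
    by (simp add: commit_bound_def)
qed

text \<open>Before the modified release date of \<open>j\<close>, some event comes no later than
  that date. Afterwards the machine is busy, and the completion of its current job is an event
  already covered by the bound of \<open>j\<close>.\<close>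

private lemma greedy_inv_wait:
  assumes inv: "greedy_inv t S"
    and busy: "\<And>j. j < n \<Longrightarrow> S j = None \<Longrightarrow> mr j \<le> t \<Longrightarrow>
        \<exists>k s. S k = Some (a j, s) \<and> t < s + real (p k (a j))"
  shows "greedy_inv (if events (t, S) = {} then t else Min (events (t, S))) S"
proof -
  let ?t = "if events (t, S) = {} then t else Min (events (t, S))"
  have Min: "?t \<le> u" if "u \<in> events (t, S)" for u
    using finite_events[OF greedy_inv_dom[OF inv]] that by auto
  have "?t \<le> commit_bound S j" if j: "j < n" "S j = None" for j
  proof (cases "t < mr j")
    case True
    obtain u where "u \<in> events (t, S)" "u \<le> mr j"
      using event_before_mod_release[of j S t] j True by blast
    then show ?thesis
      using Min[of u] commit_bound_ge[of j S] by linarith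
  next
    case False
    then obtain k s where k: "S k = Some (a j, s)" "t < s + real (p k (a j))"
      using busy[OF j] by auto
    then have "s + real (p k (a j)) \<le> commit_bound S j"
      using inv j by (simp add: greedy_inv_def)
    then show ?thesis
      using Min[OF completion_event[of S k "a j" s t]] k by linarith
  qed
  then show ?thesis
    using inv unfolding greedy_inv_def by blast
qed

text \<open>The new block may delay an uncommitted job \<open>j\<close> on the same machine. If
  \<open>j\<close> is not yet available, the processing time of \<open>k\<close> enters the first
  sum of \<open>commit_bound\<close>; otherwise the policy preferred \<open>k\<close> to
  \<open>j\<close>, and the whole block enters the second sum.\<close>

private lemma greedy_inv_commit:
  assumes inv: "greedy_inv t S"
    and k: "k < n" "S k = None" "mr k \<le> t"
    and idle: "\<And>j s. S j = Some (a k, s) \<Longrightarrow> s + real (p j (a k)) \<le> t"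
    and best: "\<And>j. j < n \<Longrightarrow> a j = a k \<Longrightarrow> S j = None \<Longrightarrow> mr j \<le> t \<Longrightarrow>
      ratio I (a k) j \<le> ratio I (a k) k"
  shows "greedy_inv t (S(k \<mapsto> (a k, t + \<mu> k)))"
proof -
  let ?S = "S(k \<mapsto> (a k, t + \<mu> k))"
  have mono: "commit_bound S j \<le> commit_bound ?S j" for j
    using k(2) by (intro commit_bound_mono) auto
  have t: "0 \<le> t"
    using k(3) mod_release_nonneg[of k] by linarith
  define D where "D S i T = {k. \<exists>s. S k = Some (i, s) \<and> s \<le> T}" for S :: "'m schedule" and i T
  have fin: "finite (D S i T)" for i T
    using greedy_inv_dom[OF inv] by (auto simp: D_def intro!: finite_subset[of _ "{..<n}"])
  have 1: "l < n \<and> i = a l \<and> mr l \<le> s - \<mu> l" if "?S l = Some (i, s)" for l i s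
  proof (cases "l = k")
    case True
    with that k show ?thesis
      by auto
  next
    case False
    then show ?thesis
      using greedy_inv_commitment[OF inv, of l i s] that by simp
  qed
  have old: "(\<Sum>l\<in>D S i T. mean I i l) \<le> T" if "0 \<le> T" for i T
    using inv that by (simp add: greedy_inv_def D_def)
  have 2: "(\<Sum>l\<in>D ?S i T. mean I i l) \<le> T" if T: "0 \<le> T" for i T
  proof (cases "i = a k \<and> t + \<mu> k \<le> T")
    case True
    then have "D ?S i T = insert k (D S i T)" "k \<notin> D S i T"
      using k(2) by (auto simp: D_def)
    \<comment> \<open>The machine is idle, so all its earlier starts are at most \<open>t\<close>,
      and the new idle period fits between \<open>t\<close> and \<open>T\<close>.\<close>
    moreover have "D S i T \<subseteq> D S i t"
      using idle True by (force simp: D_def)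
    then have "(\<Sum>l\<in>D S i T. mean I i l) \<le> (\<Sum>l\<in>D S i t. mean I i l)"
      using fin by (intro sum_mono2) auto
    then have "(\<Sum>l\<in>D S i T. mean I i l) \<le> t"
      using old[OF t, of i] by linarith
    ultimately show ?thesis
      using fin True by simp
  next
    case False
    then have "D ?S i T = D S i T"
      using k(2) by (auto simp: D_def)
    then show ?thesis
      using old[OF T] by simp
  qed
  have 3: "t \<le> commit_bound ?S j \<and>
      (\<forall>l s. ?S l = Some (a j, s) \<longrightarrow> s + real (p l (a j)) \<le> commit_bound ?S j)"
    if j: "j < n" "?S j = None" for j
  proof (intro conjI allI impI)
    have j': "S j = None" "j \<noteq> k"
      using j(2) by (auto split: if_splits)
    have le: "t \<le> commit_bound S j"
      using inv j(1) j' by (simp add: greedy_inv_def)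
    then show "t \<le> commit_bound ?S j"
      using mono[of j] by linarith
    fix l s assume l: "?S l = Some (a j, s)"
    show "s + real (p l (a j)) \<le> commit_bound ?S j"
    proof (cases "l = k")
      case False
      then have "s + real (p l (a j)) \<le> commit_bound S j"
        using inv j(1) j' l by (simp add: greedy_inv_def)
      then show ?thesis
        using mono[of j] by linarith
    next
      case True
      then have s: "a j = a k" "s = t + \<mu> k"
        using l by auto
      let ?A = "\<lambda>S. {k. k < n \<and> (\<exists>s. S k = Some (a j, s) \<and> s - mean I (a j) k < mr j)}"
      let ?B = "\<lambda>S. {k. k \<in> precedence I a j - {j} \<and> S k \<noteq> None}"
      show ?thesis
      proof (cases "t < mr j")
        case True
        \<comment> \<open>The start of \<open>k\<close> is below \<open>2 * mr j\<close>: the mean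
          of \<open>k\<close> is at most \<open>mr k\<close>, hence at most \<open>t\<close>, and
          \<open>t\<close> is below \<open>mr j\<close>.\<close>
        have "real (p k (a j)) \<le> (\<Sum>l\<in>?A ?S. real (p l (a j)))"
          using k(1) s True by (intro member_le_sum) auto
        moreover have "0 \<le> (\<Sum>l\<in>?B ?S. mean I (a j) l + real (p l (a j)))"
          by (intro sum_nonneg) simp
        ultimately show ?thesis
          using \<open>l = k\<close> s True k(3) mean_le_mod_release[of k] unfolding commit_bound_def by simp
      next
        case False
        then have "k \<in> precedence I a j"
          using best[OF j(1) s(1) j'(1)] k(1) s(1) by (simp add: precedence_def)
        then have "?B ?S = insert k (?B S)" "k \<notin> ?B S"
          using j' k(2) by auto
        moreover have "finite (?B S)"
          by (rule finite_subset[OF _ finite_precedence[of I a j]]) auto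
        ultimately have "(\<Sum>l\<in>?B ?S. mean I (a j) l + real (p l (a j))) =
            mean I (a j) k + real (p k (a j)) + (\<Sum>l\<in>?B S. mean I (a j) l + real (p l (a j)))"
          by simp
        moreover have "(\<Sum>l\<in>?A S. real (p l (a j))) \<le> (\<Sum>l\<in>?A ?S. real (p l (a j)))"
          using k(2) by (intro sum_mono2) auto
        ultimately show ?thesis
          using \<open>l = k\<close> s le unfolding commit_bound_def by simp
      qed
    qed
  qed
  have 4: "s \<le> commit_bound ?S j + \<mu> j" if "?S j = Some (i, s)" for j i s
  proof (cases "j = k")
    case True
    have "t \<le> commit_bound S k"
      using inv k by (simp add: greedy_inv_def)
    then have "t \<le> commit_bound ?S k"
      using mono[of k] by linarith
    moreover have "i = a k" "s = t + \<mu> k"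
      using that True by auto
    ultimately show ?thesis
      unfolding True by linarith
  next
    case False
    then have "S j = Some (i, s)"
      using that by simp
    then have "s \<le> commit_bound S j + \<mu> j"
      using inv unfolding greedy_inv_def by blast
    then show ?thesis
      using mono[of j] by linarith
  qed
  show ?thesis
    unfolding greedy_inv_def using 1 2[unfolded D_def] 3 4 by blast
qed

private lemma greedy_inv_step:
  assumes "greedy_inv t S" "step I \<pi> p (t, S) = (t', S')"
  shows "greedy_inv t' S'"
  by (rule greedy_step_cases[of S t])
    (use assms greedy_inv_commit[OF assms(1)] greedy_inv_wait[OF assms(1)] in simp_all)

private lemma greedy_inv_run: "greedy_inv (fst (run I \<pi> p m)) (snd (run I \<pi> p m))"
proof (induction m)
  case 0
  have "0 \<le> commit_bound (\<lambda>_. None) j" for j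
    using commit_bound_ge[of j] mod_release_nonneg[of j] order_trans by blast
  then show ?case
    by (simp add: greedy_inv_def)
next
  case (Suc m)
  obtain t S where "run I \<pi> p m = (t, S)"
    by fastforce
  with Suc greedy_inv_step[of t S] show ?case
    by (simp add: run_Suc)
qed

section \<open>Termination of the greedy run\<close>

private definition pending :: "real \<times> 'm schedule \<Rightarrow> nat" where
  "pending = (\<lambda>(t, S). 2 * card {j. j < n \<and> S j = None} + card {j. j < n \<and> t < release I j} +
     card {j. j < n \<and> t < mr j} + card {j. j < n \<and> (\<exists>i s. S j = Some (i, s) \<and> t < s + real (p j i))})"

text \<open>Waiting moves to an event strictly after \<open>t\<close>, which thereby leaves one of
  the three sets of future events in \<open>pending\<close>; an uncommitted job guarantees that
  there is such an event. A commitment removes one uncommitted job and creates at most one future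
  completion, hence the factor 2.\<close>

private lemma pending_step:
  assumes inv: "greedy_inv t S" and j: "j < n" "S j = None"
  shows "pending (step I \<pi> p (t, S)) < pending (t, S)"
proof (rule greedy_step_cases[of S t])
  fix k
  assume k: "k < n" "S k = None"
    and step: "step I \<pi> p (t, S) = (t, S(k \<mapsto> (a k, t + \<mu> k)))"
  let ?S = "S(k \<mapsto> (a k, t + \<mu> k))"
  have "{j. j < n \<and> S j = None} = insert k {j. j < n \<and> ?S j = None}"
    using k by auto
  then have "card {j. j < n \<and> S j = None} = Suc (card {j. j < n \<and> ?S j = None})"
    by simp
  moreover have "card {j. j < n \<and> (\<exists>i s. ?S j = Some (i, s) \<and> t < s + real (p j i))} \<le>
      card (insert k {j. j < n \<and> (\<exists>i s. S j = Some (i, s) \<and> t < s + real (p j i))})"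
    by (rule card_mono) auto
  moreover have "\<dots> \<le> Suc (card {j. j < n \<and> (\<exists>i s. S j = Some (i, s) \<and> t < s + real (p j i))})"
    by (rule card_insert_le_m1) auto
  ultimately show ?thesis
    unfolding step pending_def by simp
next
  assume busy: "\<And>j. j < n \<Longrightarrow> S j = None \<Longrightarrow> mr j \<le> t \<Longrightarrow>
      \<exists>k s. S k = Some (a j, s) \<and> t < s + real (p k (a j))"
    and step: "step I \<pi> p (t, S) = (if events (t, S) = {} then t else Min (events (t, S)), S)"
  have ne: "events (t, S) \<noteq> {}"
  proof (cases "t < mr j")
    case True
    then show ?thesis
      using event_before_mod_release[of j S t] j True by blast
  next
    case False
    then show ?thesis
      using busy[OF j] completion_event[of S] by fastforce
  qed
  define u where "u = Min (events (t, S))"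
  have u: "u \<in> events (t, S)"
    unfolding u_def using finite_events[OF greedy_inv_dom[OF inv]] ne by (rule Min_in)
  then have "t < u"
    by (auto simp: events_def)
  let ?R = "\<lambda>t. {j. j < n \<and> t < release I j}"
  let ?M = "\<lambda>t. {j. j < n \<and> t < mr j}"
  let ?C = "\<lambda>t. {j. j < n \<and> (\<exists>i s. S j = Some (i, s) \<and> t < s + real (p j i))}"
  have sub: "?R u \<subseteq> ?R t" "?M u \<subseteq> ?M t" "?C u \<subseteq> ?C t"
    using \<open>t < u\<close> by fastforce+
  have fin: "finite (?R t)" "finite (?M t)" "finite (?C t)"
    by auto
  have "u \<in> mr ` ?M t \<or> u \<in> release I ` {..<n} \<or> (\<exists>j i s. S j = Some (i, s) \<and> u = s + real (p j i))"
  proof -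
    let ?Q = "{mr k |k. k < n \<and> release I k \<le> t \<and> S k = None \<and> t < mr k}"
    have "Min ?Q \<in> ?Q" if "?Q \<noteq> {}"
      using that by (intro Min_in) auto
    then have "v \<in> mr ` ?M t" if "v \<in> set_option (let R = ?Q in if R = {} then None else Some (Min R))" for v
      using that by (auto simp: Let_def split: if_splits)
    then show ?thesis
      using u unfolding events_def by blast
  qed
  then have "?R u \<subset> ?R t \<or> ?M u \<subset> ?M t \<or> ?C u \<subset> ?C t"
  proof (elim disjE exE conjE)
    assume "u \<in> mr ` ?M t"
    then have "?M u \<noteq> ?M t" by auto
    then show ?thesis using sub by blast
  next
    assume "u \<in> release I ` {..<n}"
    then have "?R u \<noteq> ?R t" using \<open>t < u\<close> by auto
    then show ?thesis using sub by blast
  next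
    fix j i s assume "S j = Some (i, s)" "u = s + real (p j i)"
    moreover have "j < n"
      using greedy_inv_dom[OF inv] calculation by auto
    ultimately have "j \<in> ?C t" "j \<notin> ?C u" using \<open>t < u\<close> by auto
    then have "?C u \<noteq> ?C t" by blast
    then show ?thesis using sub by blast
  qed
  moreover have "card (?R u) \<le> card (?R t)" "card (?M u) \<le> card (?M t)" "card (?C u) \<le> card (?C t)"
    using sub fin by (auto intro: card_mono)
  ultimately have "card (?R u) + card (?M u) + card (?C u) < card (?R t) + card (?M t) + card (?C t)"
    using psubset_card_mono[OF fin(1)] psubset_card_mono[OF fin(2)] psubset_card_mono[OF fin(3)]
    by (smt (verit) add_le_less_mono add_less_le_mono add_mono)
  then show ?thesis
    unfolding step pending_def u_def using ne by simp
qed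

private lemma greedy_commits_all: "\<exists>m. \<forall>j<n. snd (run I \<pi> p m) j \<noteq> None"
proof (rule ccontr)
  assume "\<not> ?thesis"
  then have ne: "\<exists>j<n. snd (run I \<pi> p m) j = None" for m
    by meson
  have "pending (run I \<pi> p m) + m \<le> pending (run I \<pi> p 0)" for m
  proof (induction m)
    case (Suc m)
    have "pending (run I \<pi> p (Suc m)) < pending (run I \<pi> p m)"
      using pending_step[OF greedy_inv_run[of m]] ne[of m] by (auto simp: run_Suc)
    with Suc show ?case
      by linarith
  qed simp
  from this[of "Suc (pending (run I \<pi> p 0))"] show False
    by simp
qed

lemma greedy_final_schedule:
  assumes j: "j < njobs I"
  obtains s where "final_schedule I \<pi> p j = Some (a j, s)"
    "s \<le> 2 * mod_release I (a j) j +
      (\<Sum>k | k < njobs I \<and> (\<exists>s. final_schedule I \<pi> p k = Some (a j, s) \<and>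
          s - mean I (a j) k < mod_release I (a j) j). real (p k (a j))) +
      (\<Sum>k\<in>precedence I a j - {j}. mean I (a j) k + real (p k (a j))) + mean I (a j) j"
    "(\<Sum>k | k < njobs I \<and> (\<exists>s. final_schedule I \<pi> p k = Some (a j, s) \<and>
          s - mean I (a j) k < mod_release I (a j) j). mean I (a j) k) \<le> 2 * mod_release I (a j) j"
proof -
  obtain m where m: "\<And>j. j < n \<Longrightarrow> snd (run I \<pi> p m) j \<noteq> None"
    using greedy_commits_all by blast
  define S where "S = snd (run I \<pi> p m)"
  have inv: "greedy_inv (fst (run I \<pi> p m)) S"
    unfolding S_def by (rule greedy_inv_run)
  have S: "final_schedule I \<pi> p k = S k" if "k < n" for k
    using m[OF that] final_schedule_eqI[of I \<pi> p m k] by (auto simp: S_def)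
  obtain i s where sj: "S j = Some (i, s)"
    using m[OF j] by (auto simp: S_def)
  have *: "i = a j" "s \<le> commit_bound S j + \<mu> j"
    using inv sj by (auto simp: greedy_inv_def)
  have eq: "{k. k < n \<and> (\<exists>s. final_schedule I \<pi> p k = Some (a j, s) \<and> s - mean I (a j) k < mr j)} =
      {k. k < n \<and> (\<exists>s. S k = Some (a j, s) \<and> s - mean I (a j) k < mr j)}"
    using S by auto
  show ?thesis
  proof (rule that[unfolded eq])
    show "final_schedule I \<pi> p j = Some (a j, s)"
      using S[OF j] sj * by simp
    have "(\<Sum>k | k \<in> precedence I a j - {j} \<and> S k \<noteq> None. mean I (a j) k + real (p k (a j))) \<le>
        (\<Sum>k\<in>precedence I a j - {j}. mean I (a j) k + real (p k (a j)))"
      by (intro sum_mono2) auto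
    then show "s \<le> 2 * mr j +
      (\<Sum>k | k < n \<and> (\<exists>s. S k = Some (a j, s) \<and> s - mean I (a j) k < mr j). real (p k (a j))) +
      (\<Sum>k\<in>precedence I a j - {j}. mean I (a j) k + real (p k (a j))) + \<mu> j"
      using *(2) unfolding commit_bound_def by linarith
    let ?D = "{k. \<exists>s. S k = Some (a j, s) \<and> s \<le> 2 * mr j}"
    \<comment> \<open>Such a \<open>k\<close> is committed before \<open>mr j\<close>, so
      \<open>mr k\<close>, and with it the mean of \<open>k\<close>, is below \<open>mr j\<close>.
      Its start is then at most \<open>2 * mr j\<close>, and the invariant bounds the idle time
      inserted up to there.\<close>
    have "k \<in> ?D" if "S k = Some (a j, s)" "s - mean I (a j) k < mr j" for k s
    proof -
      have "a k = a j" "mr k \<le> s - \<mu> k"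
        using greedy_inv_commitment[OF inv that(1)] by auto
      then have "s \<le> 2 * mr j"
        using mean_le_mod_release[of k] that(2) by simp
      with that show ?thesis
        by blast
    qed
    moreover have "finite ?D"
      using greedy_inv_dom[OF inv] by (auto intro!: finite_subset[of _ "{..<n}"])
    ultimately have "(\<Sum>k | k < n \<and> (\<exists>s. S k = Some (a j, s) \<and> s - mean I (a j) k < mr j). mean I (a j) k)
        \<le> (\<Sum>k\<in>?D. mean I (a j) k)"
      by (intro sum_mono2) auto
    also have "\<dots> \<le> 2 * mr j"
      using inv mod_release_nonneg[of j] by (simp add: greedy_inv_def)
    finally show "(\<Sum>k | k < n \<and> (\<exists>s. S k = Some (a j, s) \<and> s - mean I (a j) k < mr j).
        mean I (a j) k) \<le> 2 * mr j" .
  qed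
qed

end

section \<open>Expected completion times\<close>

lemma nn_integral_law:
  "can_run I i j \<Longrightarrow> (\<integral>\<^sup>+v. ennreal (real (v i)) \<partial>measure_pmf (law I j)) = ennreal (mean I i j)"
  by (simp add: ennreal_mean EP_def)

lemma nn_integral_realizations_time:
  assumes "j < njobs I" "can_run I i j"
  shows "(\<integral>\<^sup>+p. ennreal (real (p j i)) \<partial>measure_pmf (realizations I)) = ennreal (mean I i j)"
  using nn_integral_realizations_resample[of j I "\<lambda>_. ()" "\<lambda>_ v. ennreal (real (v i))"] assms
  by (simp add: nn_integral_law)

lemma nn_integral_completion:
  assumes "j < njobs I"
  shows "(\<integral>\<^sup>+p. completion I \<pi> p j \<partial>measure_pmf (realizations I)) =
    (\<integral>\<^sup>+p. \<integral>\<^sup>+v. (case final_schedule I \<pi> p j of None \<Rightarrow> \<infinity> | Some (i, s) \<Rightarrow> ennreal (s + real (v i)))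
      \<partial>measure_pmf (law I j) \<partial>measure_pmf (realizations I))"
  unfolding completion_eq
  by (rule nn_integral_realizations_final_schedule[OF assms, where F =
        "\<lambda>x v. case x of None \<Rightarrow> \<infinity> | Some (i, s) \<Rightarrow> ennreal (s + real (v i))"])

lemma cost_eq:
  "cost I \<pi> = (\<Sum>j<njobs I. ennreal (weight I j) *
     (\<integral>\<^sup>+p. completion I \<pi> p j \<partial>measure_pmf (realizations I)))"
  by (simp add: cost_def nn_integral_sum nn_integral_cmult)

text \<open>The event that \<open>k\<close> is committed before the modified release date of \<open>j\<close> is independent of the
  processing time of \<open>k\<close>, so the expected work of these jobs equals the expected idle time inserted
  before them.\<close>

lemma greedy_expected_completion_le:
  assumes valid: "valid_inst I" and assignment: "greedy_assignment I a"
    and greedy: "greedy_policy I a \<pi>" and j: "j < njobs I"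
  shows "(\<integral>\<^sup>+p. completion I \<pi> p j \<partial>measure_pmf (realizations I)) \<le>
    ennreal (4 * mod_release I (a j) j + 2 * load I a j)"
proof -
  let ?i = "a j"
  let ?r = "mod_release I ?i j"
  let ?G = "precedence I a j"
  define E where "E x k \<longleftrightarrow> (\<exists>s. x = Some (?i, s) \<and> s - mean I ?i k < ?r)" for x k
  define B where "B p = {k. k < njobs I \<and> E (final_schedule I \<pi> p k) k}" for p
  have run: "can_run I (a k) k" if "k < njobs I" for k
    using assignment that by (simp add: greedy_assignment_def)
  have r: "0 \<le> ?r"
    by (simp add: mod_release_def le_max_iff_disj)
  \<comment> \<open>The sum over the random set \<open>B p\<close> is written with indicators, so
    that expectations can be taken job by job.\<close>
  have "completion I \<pi> p j \<le> ennreal (2 * ?r) +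
      (\<Sum>k<njobs I. if E (final_schedule I \<pi> p k) k then ennreal (real (p k ?i)) else 0) +
      (\<Sum>k\<in>?G. ennreal (mean I ?i k) + ennreal (real (p k ?i)))" for p
  proof -
    obtain s where s: "final_schedule I \<pi> p j = Some (?i, s)"
      "s \<le> 2 * ?r + (\<Sum>k\<in>B p. real (p k ?i)) +
        (\<Sum>k\<in>?G - {j}. mean I ?i k + real (p k ?i)) + mean I ?i j"
      using greedy_final_schedule[OF valid assignment greedy j, of p thesis] unfolding B_def E_def
      by blast
    \<comment> \<open>The idle period and the processing time of \<open>j\<close> itself are its
      term in the sum over \<open>?G\<close>.\<close>
    have "j \<in> ?G"
      using j by (simp add: precedence_def)
    then have "(\<Sum>k\<in>?G. mean I ?i k + real (p k ?i)) =
        mean I ?i j + real (p j ?i) + (\<Sum>k\<in>?G - {j}. mean I ?i k + real (p k ?i))"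
      by (intro sum.remove) simp_all
    with s(2) have "s + real (p j ?i) \<le> 2 * ?r + (\<Sum>k\<in>B p. real (p k ?i)) +
        (\<Sum>k\<in>?G. mean I ?i k + real (p k ?i))"
      by linarith
    then have "completion I \<pi> p j \<le> ennreal (2 * ?r + (\<Sum>k\<in>B p. real (p k ?i)) +
        (\<Sum>k\<in>?G. mean I ?i k + real (p k ?i)))"
      using s(1) by (simp add: completion_eq ennreal_leI)
    also have "\<dots> = ennreal (2 * ?r) + (\<Sum>k\<in>B p. ennreal (real (p k ?i))) +
        (\<Sum>k\<in>?G. ennreal (mean I ?i k) + ennreal (real (p k ?i)))"
      using r by (simp add: ennreal_plus sum_nonneg sum_ennreal flip: sum_ennreal)
    also have "(\<Sum>k\<in>B p. ennreal (real (p k ?i))) =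
        (\<Sum>k<njobs I. if E (final_schedule I \<pi> p k) k then ennreal (real (p k ?i)) else 0)"
      unfolding B_def by (rule sum.mono_neutral_cong_left) auto
    finally show ?thesis .
  qed
  then have "(\<integral>\<^sup>+p. completion I \<pi> p j \<partial>measure_pmf (realizations I)) \<le>
      (\<integral>\<^sup>+p. ennreal (2 * ?r) +
        (\<Sum>k<njobs I. if E (final_schedule I \<pi> p k) k then ennreal (real (p k ?i)) else 0) +
        (\<Sum>k\<in>?G. ennreal (mean I ?i k) + ennreal (real (p k ?i))) \<partial>measure_pmf (realizations I))"
    by (rule nn_integral_mono)
  also have "\<dots> = ennreal (2 * ?r) +
      (\<Sum>k<njobs I. \<integral>\<^sup>+p. (if E (final_schedule I \<pi> p k) k then ennreal (real (p k ?i)) else 0)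
        \<partial>measure_pmf (realizations I)) +
      (\<Sum>k\<in>?G. ennreal (mean I ?i k) +
        (\<integral>\<^sup>+p. ennreal (real (p k ?i)) \<partial>measure_pmf (realizations I)))"
    by (simp add: nn_integral_add nn_integral_sum)
  also have "(\<Sum>k\<in>?G. ennreal (mean I ?i k) +
      (\<integral>\<^sup>+p. ennreal (real (p k ?i)) \<partial>measure_pmf (realizations I))) =
      (\<Sum>k\<in>?G. ennreal (mean I ?i k) + ennreal (mean I ?i k))"
  proof (intro sum.cong refl arg_cong2[where f = "(+)"] nn_integral_realizations_time)
    fix k assume "k \<in> ?G"
    then show "k < njobs I" "can_run I ?i k"
      using run[of k] by (auto simp: precedence_def)
  qed
  also have "\<dots> = ennreal (2 * load I a j)"
    by (simp add: load_def sum_distrib_left flip: ennreal_plus)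
  also have "(\<Sum>k<njobs I. \<integral>\<^sup>+p. (if E (final_schedule I \<pi> p k) k then ennreal (real (p k ?i)) else 0)
      \<partial>measure_pmf (realizations I)) =
      (\<Sum>k<njobs I. \<integral>\<^sup>+p. (if E (final_schedule I \<pi> p k) k then ennreal (mean I ?i k) else 0)
      \<partial>measure_pmf (realizations I))"
  proof (rule sum.cong[OF refl])
    fix k assume "k \<in> {..<njobs I}"
    then have k: "k < njobs I"
      by simp
    have "(\<integral>\<^sup>+v. (if E (final_schedule I \<pi> p k) k then ennreal (real (v ?i)) else 0)
        \<partial>measure_pmf (law I k)) = (if E (final_schedule I \<pi> p k) k then ennreal (mean I ?i k) else 0)"
      for p
    proof (cases "E (final_schedule I \<pi> p k) k")
      case True
      then have "can_run I ?i k"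
        using final_schedule_admissible(2)[of I \<pi> p k ?i] by (auto simp: E_def)
      then show ?thesis
        by (simp add: nn_integral_law)
    qed simp
    then show "(\<integral>\<^sup>+p. (if E (final_schedule I \<pi> p k) k then ennreal (real (p k ?i)) else 0)
        \<partial>measure_pmf (realizations I)) =
      (\<integral>\<^sup>+p. (if E (final_schedule I \<pi> p k) k then ennreal (mean I ?i k) else 0)
        \<partial>measure_pmf (realizations I))"
      using nn_integral_realizations_final_schedule[OF k, where \<pi> = \<pi> and
          F = "\<lambda>x v. if E x k then ennreal (real (v ?i)) else 0"]
      by simp
  qed
  also have "\<dots> = (\<integral>\<^sup>+p. (\<Sum>k<njobs I. if E (final_schedule I \<pi> p k) k then ennreal (mean I ?i k) else 0)
      \<partial>measure_pmf (realizations I))"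
    by (simp add: nn_integral_sum)
  \<comment> \<open>Once work has been replaced by inserted idle time, the bound holds in every
    realization.\<close>
  also have "\<dots> \<le> (\<integral>\<^sup>+p. ennreal (2 * ?r) \<partial>measure_pmf (realizations I))"
  proof (rule nn_integral_mono)
    fix p
    have "(\<Sum>k<njobs I. if E (final_schedule I \<pi> p k) k then ennreal (mean I ?i k) else 0) =
        (\<Sum>k\<in>B p. ennreal (mean I ?i k))"
      unfolding B_def by (rule sum.mono_neutral_cong_right) auto
    also have "\<dots> = ennreal (\<Sum>k\<in>B p. mean I ?i k)"
      by simp
    also have "\<dots> \<le> ennreal (2 * ?r)"
      using greedy_final_schedule[OF valid assignment greedy j, of p "(\<Sum>k\<in>B p. mean I ?i k) \<le> 2 * ?r"]
      unfolding B_def E_def by (blast intro: ennreal_leI)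
    finally show "(\<Sum>k<njobs I. if E (final_schedule I \<pi> p k) k then ennreal (mean I ?i k) else 0)
        \<le> ennreal (2 * ?r)" .
  qed
  also have "\<dots> = ennreal (2 * ?r)"
    by simp
  finally have "(\<integral>\<^sup>+p. completion I \<pi> p j \<partial>measure_pmf (realizations I)) \<le>
      ennreal (2 * ?r) + ennreal (2 * ?r) + ennreal (2 * load I a j)"
    by (simp add: add_mono)
  also have "\<dots> = ennreal (4 * ?r + 2 * load I a j)"
    using r by (simp flip: ennreal_plus)
  finally show ?thesis .
qed

lemma greedy_cost_le:
  assumes "valid_inst I" "greedy_assignment I a" "greedy_policy I a \<pi>"
  shows "cost I \<pi> \<le> ennreal (4 * (\<Sum>j<njobs I. incr I a j (a j)))"
proof -
  have run: "can_run I (a j) j" if "j < njobs I" for j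
    using assms(2) that by (simp add: greedy_assignment_def)
  have r: "0 \<le> mod_release I (a j) j" for j
    by (simp add: mod_release_def le_max_iff_disj)
  have "cost I \<pi> \<le> (\<Sum>j<njobs I. ennreal (weight I j) *
      ennreal (4 * mod_release I (a j) j + 2 * load I a j))"
    unfolding cost_eq using greedy_expected_completion_le[OF assms]
    by (intro sum_mono mult_left_mono) auto
  also have "\<dots> = (\<Sum>j<njobs I. ennreal (weight I j * (4 * mod_release I (a j) j + 2 * load I a j)))"
    using assms(1) r by (intro sum.cong) (auto simp: weight_nonneg ennreal_mult)
  also have "\<dots> = ennreal (\<Sum>j<njobs I. weight I j * (4 * mod_release I (a j) j + 2 * load I a j))"
    using assms(1) r by (intro sum_ennreal) (auto simp: weight_nonneg)
  also have "(\<Sum>j<njobs I. weight I j * (4 * mod_release I (a j) j + 2 * load I a j)) =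
      2 * (\<Sum>j<njobs I. weight I j * (2 * mod_release I (a j) j + load I a j))"
    by (simp add: sum_distrib_left algebra_simps)
  also have "ennreal \<dots> \<le> ennreal (4 * (\<Sum>j<njobs I. incr I a j (a j)))"
    using weighted_load_le_incr[OF assms(1) run] by (intro ennreal_leI) simp
  finally show ?thesis .
qed

section \<open>A lower bound for every policy\<close>

text \<open>The second moment is the variance plus the squared mean. As the variance may be
  infinite, subtraction in \<open>ennreal\<close> is avoided: the squared mean is added on both
  sides and cancelled at the end, being finite.\<close>

lemma second_moment_le:
  assumes valid: "valid_inst I" and j: "j < njobs I" "can_run I i j"
  shows "(\<integral>\<^sup>+v. ennreal ((real (v i))\<^sup>2) \<partial>measure_pmf (law I j)) \<le>
    (1 + Delta I) * ennreal ((mean I i j)\<^sup>2)"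
proof -
  let ?p = "mean I i j"
  let ?V = "\<integral>\<^sup>+v. ennreal ((real (v i) - ?p)\<^sup>2) \<partial>measure_pmf (law I j)"
  have p: "0 < ?p"
    by (rule mean_pos[OF valid j])
  have "?V / (EP I i j)\<^sup>2 \<le> Delta I"
    unfolding Delta_def using j by (intro SUP_upper2[of "(i, j)"]) auto
  then have "?V / ennreal (?p\<^sup>2) \<le> Delta I"
    by (simp add: ennreal_mean[OF j(2), symmetric] ennreal_power)
  then have "?V / ennreal (?p\<^sup>2) * ennreal (?p\<^sup>2) \<le> Delta I * ennreal (?p\<^sup>2)"
    by (rule mult_right_mono) simp
  then have V: "?V \<le> Delta I * ennreal (?p\<^sup>2)"
    using p by (simp add: ennreal_divide_times)
  have "(\<integral>\<^sup>+v. ennreal ((real (v i))\<^sup>2) \<partial>measure_pmf (law I j)) + ennreal (?p\<^sup>2) =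
      (\<integral>\<^sup>+v. ennreal ((real (v i))\<^sup>2) + ennreal (?p\<^sup>2) \<partial>measure_pmf (law I j))"
    by (simp add: nn_integral_add)
  also have "\<dots> = (\<integral>\<^sup>+v. ennreal ((real (v i) - ?p)\<^sup>2) + ennreal (2 * ?p) * ennreal (real (v i))
      \<partial>measure_pmf (law I j))"
  proof (rule nn_integral_cong)
    fix v :: "'a \<Rightarrow> nat"
    have "(real (v i))\<^sup>2 + ?p\<^sup>2 = (real (v i) - ?p)\<^sup>2 + 2 * ?p * real (v i)"
      by (simp add: power2_eq_square algebra_simps)
    then show "ennreal ((real (v i))\<^sup>2) + ennreal (?p\<^sup>2) =
        ennreal ((real (v i) - ?p)\<^sup>2) + ennreal (2 * ?p) * ennreal (real (v i))"
      by (simp flip: ennreal_plus ennreal_mult)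
  qed
  also have "\<dots> = ?V + ennreal (2 * ?p) * ennreal ?p"
    by (simp add: nn_integral_add nn_integral_cmult nn_integral_law[OF j(2)])
  also have "ennreal (2 * ?p) * ennreal ?p = ennreal (?p\<^sup>2) + ennreal (?p\<^sup>2)"
    by (simp add: power2_eq_square flip: ennreal_plus ennreal_mult)
  finally have "ennreal (?p\<^sup>2) + (\<integral>\<^sup>+v. ennreal ((real (v i))\<^sup>2) \<partial>measure_pmf (law I j)) =
      ennreal (?p\<^sup>2) + (?V + ennreal (?p\<^sup>2))"
    by (simp add: ac_simps)
  then have "(\<integral>\<^sup>+v. ennreal ((real (v i))\<^sup>2) \<partial>measure_pmf (law I j)) = ?V + ennreal (?p\<^sup>2)"
    by (simp add: ennreal_add_left_cancel)
  with V show ?thesis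
    by (simp add: distrib_right add.commute add_mono)
qed

text \<open>The value of the dual variables of the machine of \<open>j\<close> at the completion of \<open>j\<close>, times the
  processing time of \<open>j\<close>.  Here \<open>\<pi>\<close> is an arbitrary policy and \<open>a\<close> the greedy assignment.\<close>

definition late_charge :: "'m sched_inst \<Rightarrow> (nat \<Rightarrow> 'm) \<Rightarrow> 'm policy \<Rightarrow> 'm realization \<Rightarrow> nat \<Rightarrow> real" where
  "late_charge I a \<pi> p j = (\<Sum>k<njobs I.
     if \<exists>s. final_schedule I \<pi> p j = Some (a k, s) \<and> s + real (p j (a k)) < load I a k / 4
     then weight I k * real (p j (a k)) else 0)"

lemma late_charge_eq:
  assumes "final_schedule I \<pi> p j = Some (i, s)"
  shows "late_charge I a \<pi> p j =
    (\<Sum>k | k < njobs I \<and> a k = i \<and> s + real (p j i) < load I a k / 4. weight I k) * real (p j i)"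
  unfolding late_charge_def sum_distrib_right
  by (rule sum.mono_neutral_cong_right) (use assms in auto)

lemma late_charge_nonneg: "valid_inst I \<Longrightarrow> 0 \<le> late_charge I a \<pi> p j"
  unfolding late_charge_def by (auto intro!: sum_nonneg simp: weight_nonneg)

text \<open>After exchanging the sums, \<open>k\<close> is charged its weight times the work
  completed on \<open>a k\<close> before time \<open>load I a k / 4\<close>, and a machine completes
  at most that much work by then.\<close>

lemma sum_late_charge_le:
  assumes valid: "valid_inst I"
    and fin: "\<And>j. j < njobs I \<Longrightarrow> final_schedule I \<pi> p j \<noteq> None"
  shows "(\<Sum>j<njobs I. late_charge I a \<pi> p j) \<le> (\<Sum>k<njobs I. weight I k * (load I a k / 4))"
proof -
  let ?n = "njobs I"
  obtain m where m: "\<And>j. j < ?n \<Longrightarrow> snd (run I \<pi> p m) j = final_schedule I \<pi> p j"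
    using final_schedule_reached[OF fin] by blast
  let ?D = "\<lambda>k. {j. j < ?n \<and> (\<exists>s. final_schedule I \<pi> p j = Some (a k, s) \<and>
    s + real (p j (a k)) < load I a k / 4)}"
  have "(\<Sum>j<?n. late_charge I a \<pi> p j) = (\<Sum>k<?n. \<Sum>j<?n.
     if \<exists>s. final_schedule I \<pi> p j = Some (a k, s) \<and> s + real (p j (a k)) < load I a k / 4
     then weight I k * real (p j (a k)) else 0)"
    unfolding late_charge_def by (rule sum.swap)
  also have "\<dots> = (\<Sum>k<?n. weight I k * (\<Sum>j\<in>?D k. real (p j (a k))))"
    unfolding sum_distrib_left by (intro sum.cong refl sum.mono_neutral_cong_right) auto
  also have "\<dots> \<le> (\<Sum>k<?n. weight I k * (load I a k / 4))"
  proof (intro sum_mono mult_left_mono)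
    fix k
    have "(\<Sum>j\<in>?D k. real (p j (a k))) \<le> (\<Sum>j | \<exists>s. snd (run I \<pi> p m) j = Some (a k, s) \<and>
        s + real (p j (a k)) \<le> load I a k / 4. real (p j (a k)))"
    proof (rule sum_mono2)
      show "finite {j. \<exists>s. snd (run I \<pi> p m) j = Some (a k, s) \<and>
          s + real (p j (a k)) \<le> load I a k / 4}"
        by (rule finite_subset[of _ "{..<?n}"]) (auto dest: run_commitment_admissible)
    qed (use m in \<open>auto intro: less_imp_le\<close>)
    also have "\<dots> \<le> load I a k / 4"
      by (rule run_completed_work_le[OF valid]) simp
    finally show "(\<Sum>j\<in>?D k. real (p j (a k))) \<le> load I a k / 4" .
  qed (use valid in \<open>simp add: weight_nonneg\<close>)
  finally show ?thesis .
qed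

lemma feasible_policy_commits:
  assumes "feasible_policy I \<pi>" "p \<in> set_pmf (realizations I)" "j < njobs I"
  shows "final_schedule I \<pi> p j \<noteq> None"
proof -
  have "completion I \<pi> p j < \<infinity>"
    using assms unfolding feasible_policy_def by blast
  then show ?thesis
    unfolding completion_eq by (cases "final_schedule I \<pi> p j") simp_all
qed

text \<open>The processing time divided by its mean has expectation one and is independent of the
  machine and start of \<open>j\<close>. Multiplying by it preserves the increment in expectation
  and turns the dual term of \<open>greedy_incr_le\<close> into \<open>late_charge\<close>.\<close>

lemma incr_le_expected_completion:
  assumes valid: "valid_inst I" and assignment: "greedy_assignment I a"
    and feasible: "feasible_policy I \<pi>" and j: "j < njobs I"
  shows "ennreal (incr I a j (a j)) \<le>
    (8 + 4 * Delta I) * (ennreal (weight I j) *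
      (\<integral>\<^sup>+p. completion I \<pi> p j \<partial>measure_pmf (realizations I))) +
    (\<integral>\<^sup>+p. ennreal (late_charge I a \<pi> p j) \<partial>measure_pmf (realizations I))"
proof -
  let ?w = "weight I j" and ?\<alpha> = "incr I a j (a j)"
  let ?R = "measure_pmf (realizations I)" and ?Q = "measure_pmf (law I j)"
  \<comment> \<open>\<open>F\<close> is the increment times the normalized processing time, and
    \<open>K\<close> is its bound apart from the late charge. The value 0 for an uncommitted job
    keeps the pointwise comparisons valid for every \<open>p\<close>.\<close>
  define F where "F x v = (case x of None \<Rightarrow> 0 | Some (i, s) \<Rightarrow>
    ennreal (?\<alpha> * (real (v i) / mean I i j)))" for x :: "('a \<times> real) option" and v :: "'a \<Rightarrow> nat"
  define K where "K x v = (case x of None \<Rightarrow> 0 | Some (i, s) \<Rightarrow>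
    ennreal (?w * (8 * s * (real (v i) / mean I i j) + 3 * real (v i) + 4 * (real (v i))\<^sup>2 / mean I i j)))"
    for x :: "('a \<times> real) option" and v :: "'a \<Rightarrow> nat"
  have w: "0 \<le> ?w"
    by (rule weight_nonneg[OF valid j])
  have \<alpha>: "0 \<le> ?\<alpha>"
    by (rule incr_nonneg[OF valid j])
  have fin: "final_schedule I \<pi> p j \<noteq> None" if "p \<in> set_pmf (realizations I)" for p
    by (rule feasible_policy_commits[OF feasible that j])
  have adm: "can_run I i j" "0 < mean I i j" "release I j \<le> s" "0 \<le> s"
    if "final_schedule I \<pi> p j = Some (i, s)" for p i s
  proof -
    show i: "can_run I i j" and s: "release I j \<le> s"
      using final_schedule_admissible[OF that] by auto
    show "0 < mean I i j"
      by (rule mean_pos[OF valid j i])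
    show "0 \<le> s"
      using valid j s by (auto simp: valid_inst_def)
  qed
  have "ennreal ?\<alpha> = (\<integral>\<^sup>+p. \<integral>\<^sup>+v. F (final_schedule I \<pi> p j) v \<partial>?Q \<partial>?R)"
  proof -
    have "(\<integral>\<^sup>+v. F (final_schedule I \<pi> p j) v \<partial>?Q) = ennreal ?\<alpha>"
      if p: "p \<in> set_pmf (realizations I)" for p
    proof -
      obtain i s where sj: "final_schedule I \<pi> p j = Some (i, s)"
        using fin[OF p] by auto
      note i = adm[OF sj]
      have "(\<integral>\<^sup>+v. F (final_schedule I \<pi> p j) v \<partial>?Q) =
          (\<integral>\<^sup>+v. ennreal (?\<alpha> / mean I i j) * ennreal (real (v i)) \<partial>?Q)"
        using \<alpha> i by (simp add: F_def sj flip: ennreal_mult)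
      also have "\<dots> = ennreal (?\<alpha> / mean I i j) * ennreal (mean I i j)"
        by (simp add: nn_integral_cmult nn_integral_law i)
      also have "\<dots> = ennreal ?\<alpha>"
        using \<alpha> i by (simp flip: ennreal_mult)
      finally show ?thesis .
    qed
    then have "(\<integral>\<^sup>+p. \<integral>\<^sup>+v. F (final_schedule I \<pi> p j) v \<partial>?Q \<partial>?R) = (\<integral>\<^sup>+p. ennreal ?\<alpha> \<partial>?R)"
      by (intro nn_integral_cong_AE) (simp add: AE_measure_pmf_iff)
    then show ?thesis
      by simp
  qed
  also have "\<dots> = (\<integral>\<^sup>+p. F (final_schedule I \<pi> p j) (p j) \<partial>?R)"
    by (rule nn_integral_realizations_final_schedule[OF j, symmetric])
  also have "\<dots> \<le> (\<integral>\<^sup>+p. K (final_schedule I \<pi> p j) (p j) + ennreal (late_charge I a \<pi> p j) \<partial>?R)"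
  proof (rule nn_integral_mono)
    fix p
    show "F (final_schedule I \<pi> p j) (p j) \<le>
        K (final_schedule I \<pi> p j) (p j) + ennreal (late_charge I a \<pi> p j)"
    proof (cases "final_schedule I \<pi> p j")
      case None
      then show ?thesis
        by (simp add: F_def)
    next
      case (Some x)
      then obtain i s where sj: "final_schedule I \<pi> p j = Some (i, s)"
        by (cases x) auto
      note i = adm[OF sj]
      let ?P = "real (p j i)" and ?p = "mean I i j"
      let ?U = "\<Sum>k | k < njobs I \<and> a k = i \<and> s + ?P < load I a k / 4. weight I k"
      \<comment> \<open>The threshold is the realized completion time \<open>s + ?P\<close>.\<close>
      have "?\<alpha> \<le> ?w * (4 * s + 3 * ?p + 4 * (s + ?P)) + ?p * ?U"
        using i by (intro greedy_incr_le[OF valid assignment j]) auto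
      then have "?\<alpha> * (?P / ?p) \<le> (?w * (4 * s + 3 * ?p + 4 * (s + ?P)) + ?p * ?U) * (?P / ?p)"
        using i by (intro mult_right_mono) auto
      also have "\<dots> = ?w * (8 * s * (?P / ?p) + 3 * ?P + 4 * ?P\<^sup>2 / ?p) + ?U * ?P"
        using i by (simp add: field_simps power2_eq_square)
      finally have "F (final_schedule I \<pi> p j) (p j) \<le>
          ennreal (?w * (8 * s * (?P / ?p) + 3 * ?P + 4 * ?P\<^sup>2 / ?p) + ?U * ?P)"
        by (simp add: F_def sj ennreal_leI)
      also have "\<dots> = K (final_schedule I \<pi> p j) (p j) + ennreal (late_charge I a \<pi> p j)"
        unfolding K_def late_charge_eq[OF sj] sj option.case prod.case
        using w i valid
        by (intro ennreal_plus mult_nonneg_nonneg add_nonneg_nonneg sum_nonneg divide_nonneg_pos)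
          (auto simp: weight_nonneg)
      finally show ?thesis .
    qed
  qed
  also have "\<dots> = (\<integral>\<^sup>+p. \<integral>\<^sup>+v. K (final_schedule I \<pi> p j) v \<partial>?Q \<partial>?R) +
      (\<integral>\<^sup>+p. ennreal (late_charge I a \<pi> p j) \<partial>?R)"
    using nn_integral_realizations_final_schedule[OF j, of K \<pi>] by (simp add: nn_integral_add)
  also have "(\<integral>\<^sup>+p. \<integral>\<^sup>+v. K (final_schedule I \<pi> p j) v \<partial>?Q \<partial>?R) \<le>
      (\<integral>\<^sup>+p. (8 + 4 * Delta I) * (ennreal ?w * (\<integral>\<^sup>+v. (case final_schedule I \<pi> p j of None \<Rightarrow> \<infinity>
         | Some (i, s) \<Rightarrow> ennreal (s + real (v i))) \<partial>?Q)) \<partial>?R)"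
  proof (rule nn_integral_mono)
    fix p
    show "(\<integral>\<^sup>+v. K (final_schedule I \<pi> p j) v \<partial>?Q) \<le>
      (8 + 4 * Delta I) * (ennreal ?w * (\<integral>\<^sup>+v. (case final_schedule I \<pi> p j of None \<Rightarrow> \<infinity>
         | Some (i, s) \<Rightarrow> ennreal (s + real (v i))) \<partial>?Q))"
    proof (cases "final_schedule I \<pi> p j")
      case None
      then show ?thesis
        by (simp add: K_def)
    next
      case (Some x)
      then obtain i s where sj: "final_schedule I \<pi> p j = Some (i, s)"
        by (cases x) auto
      note i = adm[OF sj]
      let ?p = "mean I i j"
      have "K (Some (i, s)) v = ennreal ?w * ((ennreal (8 * s / ?p) + 3) * ennreal (real (v i)) +
          ennreal (4 / ?p) * ennreal ((real (v i))\<^sup>2))" for v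
      proof -
        have "?w * (8 * s * (real (v i) / ?p) + 3 * real (v i) + 4 * (real (v i))\<^sup>2 / ?p) =
            ?w * ((8 * s / ?p + 3) * real (v i) + 4 / ?p * (real (v i))\<^sup>2)"
          by (simp add: algebra_simps)
        moreover have "ennreal (8 * s / ?p) + 3 = ennreal (8 * s / ?p + 3)"
          using i by (simp add: ennreal_plus)
        ultimately show ?thesis
          using w i unfolding K_def by (simp flip: ennreal_plus ennreal_mult)
      qed
      then have "(\<integral>\<^sup>+v. K (final_schedule I \<pi> p j) v \<partial>?Q) =
          ennreal ?w * ((ennreal (8 * s / ?p) + 3) * ennreal ?p +
            ennreal (4 / ?p) * (\<integral>\<^sup>+v. ennreal ((real (v i))\<^sup>2) \<partial>?Q))"
        by (simp add: sj nn_integral_add nn_integral_cmult nn_integral_law i)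
      also have "\<dots> \<le> ennreal ?w * ((ennreal (8 * s / ?p) + 3) * ennreal ?p +
            ennreal (4 / ?p) * ((1 + Delta I) * ennreal (?p\<^sup>2)))"
        by (intro mult_left_mono add_left_mono second_moment_le[OF valid j i(1)]) simp_all
      also have "(ennreal (8 * s / ?p) + 3) * ennreal ?p = 8 * ennreal s + 3 * ennreal ?p"
      proof -
        have "ennreal (8 * s / ?p) * ennreal ?p = 8 * ennreal s"
          using i by (simp add: ennreal_mult flip: ennreal_mult'')
        then show ?thesis
          by (simp add: distrib_right)
      qed
      also have "ennreal (4 / ?p) * ((1 + Delta I) * ennreal (?p\<^sup>2)) = (4 + 4 * Delta I) * ennreal ?p"
      proof -
        have "ennreal (4 / ?p) * ennreal (?p\<^sup>2) = 4 * ennreal ?p"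
          using i by (simp add: power2_eq_square flip: ennreal_mult ennreal_numeral)
        then have "(1 + Delta I) * (ennreal (4 / ?p) * ennreal (?p\<^sup>2)) = (1 + Delta I) * (4 * ennreal ?p)"
          by simp
        then show ?thesis
          by (simp add: algebra_simps)
      qed
      also have "8 * ennreal s + 3 * ennreal ?p + (4 + 4 * Delta I) * ennreal ?p =
          8 * ennreal s + (7 + 4 * Delta I) * ennreal ?p"
      proof -
        have "3 * ennreal ?p + (4 + 4 * Delta I) * ennreal ?p = (3 + (4 + 4 * Delta I)) * ennreal ?p"
          by (simp only: distrib_right)
        also have "3 + (4 + 4 * Delta I) = 7 + 4 * Delta I"
          by (simp add: add.assoc[symmetric])
        finally show ?thesis
          by (simp add: add.assoc)
      qed
      \<comment> \<open>Both coefficients are raised to \<open>8 + 4 * Delta I\<close>, so that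
        start and mean combine to the expected completion time.\<close>
      also have "8 * ennreal s + (7 + 4 * Delta I) * ennreal ?p \<le>
          (8 + 4 * Delta I) * ennreal s + (8 + 4 * Delta I) * ennreal ?p"
        by (intro add_mono mult_right_mono) simp_all
      also have "\<dots> = (8 + 4 * Delta I) * ennreal (s + ?p)"
        using i by (simp add: distrib_left)
      also have "ennreal (s + ?p) = (\<integral>\<^sup>+v. ennreal (s + real (v i)) \<partial>?Q)"
        using i by (simp add: nn_integral_add nn_integral_law)
      finally show ?thesis
        by (simp add: sj mult_left_mono mult.left_commute)
    qed
  qed
  also have "\<dots> = (8 + 4 * Delta I) * (ennreal ?w * (\<integral>\<^sup>+p. completion I \<pi> p j \<partial>?R))"
    by (simp add: nn_integral_cmult nn_integral_completion[OF j])
  finally show ?thesis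
    by (simp add: add_right_mono)
qed

text \<open>The late charges total at most a quarter of the weighted loads, hence at most half of
  the increments, and this half is finite and can be cancelled. The divisor 4 in the load threshold
  is chosen for this.\<close>

lemma sum_incr_le_cost:
  assumes valid: "valid_inst I" and assignment: "greedy_assignment I a"
    and feasible: "feasible_policy I \<pi>"
  shows "ennreal ((\<Sum>j<njobs I. incr I a j (a j)) / 2) \<le> (8 + 4 * Delta I) * cost I \<pi>"
proof -
  let ?A = "\<Sum>j<njobs I. incr I a j (a j)" and ?R = "measure_pmf (realizations I)"
  have run: "can_run I (a j) j" if "j < njobs I" for j
    using assignment that by (simp add: greedy_assignment_def)
  have nonneg: "0 \<le> incr I a j (a j)" if "j < njobs I" for j
    by (rule incr_nonneg[OF valid that])
  have "ennreal ?A = (\<Sum>j<njobs I. ennreal (incr I a j (a j)))"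
    using nonneg by (intro sum_ennreal[symmetric]) simp
  also have "\<dots> \<le> (\<Sum>j<njobs I. (8 + 4 * Delta I) * (ennreal (weight I j) *
      (\<integral>\<^sup>+p. completion I \<pi> p j \<partial>?R)) + (\<integral>\<^sup>+p. ennreal (late_charge I a \<pi> p j) \<partial>?R))"
    by (intro sum_mono incr_le_expected_completion[OF valid assignment feasible]) simp
  also have "\<dots> = (8 + 4 * Delta I) * cost I \<pi> +
      (\<integral>\<^sup>+p. ennreal (\<Sum>j<njobs I. late_charge I a \<pi> p j) \<partial>?R)"
    by (simp add: sum.distrib cost_eq nn_integral_sum late_charge_nonneg[OF valid]
        flip: sum_distrib_left sum_ennreal)
  also have "(\<integral>\<^sup>+p. ennreal (\<Sum>j<njobs I. late_charge I a \<pi> p j) \<partial>?R) \<le> (\<integral>\<^sup>+p. ennreal (?A / 2) \<partial>?R)"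
  proof (intro nn_integral_mono_AE, unfold AE_measure_pmf_iff, intro ballI ennreal_leI)
    fix p assume "p \<in> set_pmf (realizations I)"
    then have "(\<Sum>j<njobs I. late_charge I a \<pi> p j) \<le> (\<Sum>k<njobs I. weight I k * (load I a k / 4))"
      by (intro sum_late_charge_le[OF valid] feasible_policy_commits[OF feasible])
    also have "\<dots> = (\<Sum>k<njobs I. weight I k * load I a k) / 4"
      by (simp add: sum_divide_distrib)
    also have "(\<Sum>k<njobs I. weight I k * load I a k) \<le>
        (\<Sum>j<njobs I. weight I j * (2 * mod_release I (a j) j + load I a j))"
      by (intro sum_mono mult_left_mono)
        (auto simp: mod_release_def le_max_iff_disj weight_nonneg[OF valid])
    also have "\<dots> \<le> 2 * ?A"
      by (rule weighted_load_le_incr[OF valid run])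
    finally show "(\<Sum>j<njobs I. late_charge I a \<pi> p j) \<le> ?A / 2"
      by simp
  qed
  finally have "ennreal ?A \<le> (8 + 4 * Delta I) * cost I \<pi> + ennreal (?A / 2)"
    by simp
  also have "ennreal ?A = ennreal (?A / 2) + ennreal (?A / 2)"
  proof -
    have "0 \<le> ?A / 2"
      using nonneg by (intro divide_nonneg_pos sum_nonneg) auto
    then show ?thesis
      by (subst ennreal_plus[symmetric]) simp_all
  qed
  finally show ?thesis
    by (simp add: add.commute ennreal_add_left_cancel_le)
qed

text \<open>Serves the case of infinite \<open>Delta I\<close>, where \<open>OPT I = 0\<close> makes
  the claimed bound 0. Every policy pays at least the weight of \<open>j\<close> times its smallest
  mean, which is a minimum over finitely many machines and so positive.\<close>

lemma weight_eq_0_if_OPT_eq_0: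
  assumes valid: "valid_inst I" and run: "can_run I (a j) j" and j: "j < njobs I"
    and OPT: "OPT I = 0"
  shows "weight I j = 0"
proof -
  let ?M = "{i. can_run I i j}"
  let ?m = "INF i\<in>?M. EP I i j"
  have "?m \<in> (\<lambda>i. EP I i j) ` ?M"
  proof -
    have "finite ?M"
      using valid by (auto simp: valid_inst_def can_run_def intro: rev_finite_subset)
    then show ?thesis
      using run by (subst cInf_eq_Min) (auto intro!: Min_in)
  qed
  then have m: "0 < ?m"
    using valid j by (auto simp: valid_inst_def can_run_def)
  have "ennreal (weight I j) * ?m \<le> cost I \<pi>" for \<pi>
  proof -
    let ?R = "measure_pmf (realizations I)"
    have "?m = (\<integral>\<^sup>+p. ?m \<partial>?R)"
      by simp
    also have "\<dots> \<le> (\<integral>\<^sup>+p. completion I \<pi> p j \<partial>?R)"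
      unfolding nn_integral_completion[OF j]
    proof (rule nn_integral_mono)
      fix p
      show "?m \<le> (\<integral>\<^sup>+v. (case final_schedule I \<pi> p j of None \<Rightarrow> \<infinity>
          | Some (i, s) \<Rightarrow> ennreal (s + real (v i))) \<partial>measure_pmf (law I j))"
      proof (cases "final_schedule I \<pi> p j")
        case None
        then show ?thesis
          by simp
      next
        case (Some x)
        then obtain i s where sj: "final_schedule I \<pi> p j = Some (i, s)"
          by (cases x) auto
        note adm = final_schedule_admissible[OF sj]
        have "?m \<le> EP I i j"
          using adm by (intro INF_lower) simp
        also have "\<dots> \<le> (\<integral>\<^sup>+v. ennreal (s + real (v i)) \<partial>measure_pmf (law I j))"
        proof -
          have "0 \<le> s"
            using adm(3) valid j by (auto simp: valid_inst_def intro: order_trans)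
          then show ?thesis
            unfolding EP_def by (intro nn_integral_mono ennreal_leI) simp
        qed
        finally show ?thesis
          by (simp add: sj)
      qed
    qed
    finally have "ennreal (weight I j) * ?m \<le>
        ennreal (weight I j) * (\<integral>\<^sup>+p. completion I \<pi> p j \<partial>?R)"
      by (rule mult_left_mono) simp
    also have "\<dots> \<le> cost I \<pi>"
      unfolding cost_eq using j by (intro member_le_sum[where f =
        "\<lambda>j. ennreal (weight I j) * (\<integral>\<^sup>+p. completion I \<pi> p j \<partial>?R)"]) auto
    finally show ?thesis .
  qed
  then have "ennreal (weight I j) * ?m \<le> OPT I"
    unfolding OPT_def by (intro INF_greatest) simp
  then show ?thesis
    using OPT m weight_nonneg[OF valid j] by (auto simp: ennreal_eq_0_iff)
qed

theorem theorem3: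
  fixes I :: "'m sched_inst" and a :: "nat \<Rightarrow> 'm" and \<pi> :: "'m policy"
  assumes "valid_inst I"
    and "greedy_assignment I a"
    and "greedy_policy I a \<pi>"
  shows "cost I \<pi> \<le> (72 + 36 * Delta I) * OPT I"
proof -
  let ?A = "\<Sum>j<njobs I. incr I a j (a j)" and ?c = "72 + 36 * Delta I"
  have cost: "cost I \<pi> \<le> ?c * cost I \<pi>'" if "feasible_policy I \<pi>'" for \<pi>'
  proof -
    have "cost I \<pi> \<le> ennreal (4 * ?A)"
      by (rule greedy_cost_le[OF assms])
    also have "4 * ?A = 8 * (?A / 2)"
      by simp
    also have "ennreal \<dots> = 8 * ennreal (?A / 2)"
      by (subst ennreal_mult') simp_all
    also have "\<dots> \<le> 8 * ((8 + 4 * Delta I) * cost I \<pi>')"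
      by (intro mult_left_mono sum_incr_le_cost[OF assms(1,2) that]) simp
    also have "\<dots> = (64 + 32 * Delta I) * cost I \<pi>'"
      by (simp add: algebra_simps)
    \<comment> \<open>The argument yields \<open>64 + 32 * Delta I\<close>, which is below the
      stated constant.\<close>
    also have "\<dots> \<le> ?c * cost I \<pi>'"
      by (intro mult_right_mono add_mono) simp_all
    finally show ?thesis .
  qed
  \<comment> \<open>Passing to the infimum divides by the constant, which must be finite for this.
    For infinite \<open>Delta I\<close> the right-hand side is 0 or infinite, according to whether
    \<open>OPT I\<close> is 0.\<close>
  consider "Delta I \<noteq> \<top>" | "Delta I = \<top>" "OPT I = 0" | "Delta I = \<top>" "OPT I \<noteq> 0"
    by blast
  then show ?thesis
  proof cases
    case 1
    then have c: "?c \<noteq> 0" "?c \<noteq> \<top>"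
      by (auto simp: ennreal_mult_eq_top_iff)
    have "cost I \<pi> / ?c \<le> OPT I"
      unfolding OPT_def using cost c by (intro INF_greatest divide_le_posI_ennreal) (auto simp: zero_less_iff_neq_zero)
    then have "cost I \<pi> / ?c * ?c \<le> OPT I * ?c"
      by (rule mult_right_mono) simp
    moreover have "cost I \<pi> / ?c * ?c = cost I \<pi>"
      using c by (subst ennreal_divide_times) (simp add: top.not_eq_extremum)
    ultimately show ?thesis
      by (simp only: mult.commute)
  next
    case 2
    have "weight I j = 0" if "j < njobs I" for j
      using weight_eq_0_if_OPT_eq_0[OF assms(1) _ that 2(2), of a] assms(2) that
      by (simp add: greedy_assignment_def)
    then show ?thesis
      by (simp add: cost_def)
  next
    case 3
    then show ?thesis
      by (simp add: ennreal_mult_top ennreal_top_mult)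
  qed
qed

end
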